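(* Let $N$ be even, $3\le n\le m$, $1\le k<N/2$, and let $\alpha$ be an integer with $2\le\alpha<n$. Let $\mathcal{T}=\bigcup_{\ell,p=0}^{k}\{\sigma_{\mathscr{A}_{\ell,p}}\}$. Then: (i) any $\omega\in(\mathbf{-1}\to\mathcal{T})_{opt}$ must pass through some configuration $\sigma^A\in\mathcal{G}^A$; (ii) any $\omega\in(\mathbf{+1}\to\mathcal{T})_{opt}$ must pass through some configuration $\sigma^B\in\mathcal{G}^B$.
   Context: Let $V=\{(i,j)\in\mathbb{Z}^2: 1\le i,j\le N\}$ be the vertex set of the $N\times N$ grid graph with periodic boundary conditions (toric grid), with edge set $E$. The columns of the torus are partitioned, in cyclic order, into four vertical strips (unions of consecutive full columns) $A,S_1,B,S_2$ of widths $n,k,m,k$, so $N=n+m+2k$. Configurations are $\sigma\in\mathcal{X}=\{-1,+1\}^V$, with Hamiltonian $$H(\sigma)=-\sum_{i\in A}\sigma_i+\sum_{i\in B}\sigma_i-\frac{\alpha}{2}\sum_{(i,j)\in E}\sigma_i\sigma_j .$$ $\mathbf{+1},\mathbf{-1}$ are the constant configurations. For $\bar V\subset V$, $\sigma_{\bar V}$ equals $+1$ on $\bar V$ and $-1$ off $\bar V$. For $0\le\ell,p\le k$, $\mathscr{A}_{\ell,p}$ is the union of $A$, the $\ell$ columns of $S_1$ closest to $A$ and the $p$ columns of $S_2$ closest to $A$. A path is a finite sequence of configurations, consecutive ones differing at exactly one site. For a configuration $\eta$ and a set $W\subset\mathcal{X}$, $\Phi(\eta,W)$ is the minimum over all paths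 $\omega$ from $\eta$ to an element of $W$ of $\max_{\zeta\in\omega}H(\zeta)$, and $(\eta\to W)_{opt}$ is the set of paths from $\eta$ to an element of $W$ attaining this minimum. Identify a set of sites with the union of the closed unit squares centered at its sites. For $1\le a,b\le N-2$, $0\le q\le\min\{a,b\}-1$ and $S\subset V$, $\mathscr{R}^S_{a,b,q}$ denotes a subset of sites of $S$ whose associated union of squares is an $a\times b$ rectangle with a protuberance of length $q$ (an edge-connected bar of $q$ unit squares) attached to the shortest side. $\mathcal{G}^A$ is the set of all configurations with positive opinion exactly on a set $\mathscr{R}^A_{\alpha,\alpha-1,1}\subset A$ and negative opinion elsewhere. $\mathcal{G}^B$ is the set of all configurations with negative opinion exactly on a set $\mathscr{R}^B_{\alpha,\alpha-1,1}\subset B$ and positive opinion elsewhere.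
   Formalization: In the gates the unit protuberance is attached to a longest side (length α) of the α×(α−1) rectangle, not to the shortest side, since with the shortest side the claim is false; the bound q ≤ min{a,b}−1 is dropped, as it would exclude α=2. *)

theory Defs
  imports "HOL-Analysis.Analysis" "HOL-Library.FuncSet" "HOL-Number_Theory.Cong"
begin

type_synonym site = "int \<times> int"
type_synonym config = "site \<Rightarrow> int"

text \<open>The first coordinate of a site is its column, the second one its row.\<close>

definition V :: "nat \<Rightarrow> site set" where
  "V N = {1..int N} \<times> {1..int N}"

definition E :: "nat \<Rightarrow> site set set" where
  "E N = {{u, v} | u v. u \<in> V N \<and> v \<in> V N \<and>
            ([fst v = fst u + 1] (mod int N) \<and> snd v = snd u \<or>
             fst v = fst u \<and> [snd v = snd u + 1] (mod int N))}"

text \<open>The \<open>w\<close> consecutive full columns \<open>s, s + 1, \<dots>, s + w - 1\<close>, taken modulo \<open>N\<close>.\<close>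

definition strip :: "nat \<Rightarrow> int \<Rightarrow> nat \<Rightarrow> site set" where
  "strip N s w = {u \<in> V N. (fst u - s) mod int N < int w}"

text \<open>The cyclic order of the strips is \<open>A, S\<^sub>1, B, S\<^sub>2\<close>; the column \<open>c\<close> where \<open>A\<close> starts
  is arbitrary.\<close>

definition strip_A :: "nat \<Rightarrow> int \<Rightarrow> nat \<Rightarrow> site set" where
  "strip_A N c n = strip N c n"

definition strip_B :: "nat \<Rightarrow> int \<Rightarrow> nat \<Rightarrow> nat \<Rightarrow> nat \<Rightarrow> site set" where
  "strip_B N c n m k = strip N (c + int n + int k) m"

text \<open>\<open>S\<^sub>1\<close> starts right after \<open>A\<close> and \<open>S\<^sub>2\<close> ends right before \<open>A\<close>, so the columns
  closest to \<open>A\<close> are the first \<open>l\<close> ones of \<open>S\<^sub>1\<close> and the last \<open>p\<close> ones of \<open>S\<^sub>2\<close>.\<close>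

definition strip_A_ext :: "nat \<Rightarrow> int \<Rightarrow> nat \<Rightarrow> nat \<Rightarrow> nat \<Rightarrow> site set" where
  "strip_A_ext N c n l p =
     strip_A N c n \<union> strip N (c + int n) l \<union> strip N (c - int p) p"

definition configs :: "nat \<Rightarrow> config set" where
  "configs N = (V N \<rightarrow>\<^sub>E {-1, 1})"

definition const_config :: "nat \<Rightarrow> int \<Rightarrow> config" where
  "const_config N s = (\<lambda>v\<in>V N. s)"

definition set_config :: "nat \<Rightarrow> site set \<Rightarrow> config" where
  "set_config N W = (\<lambda>v\<in>V N. if v \<in> W then 1 else -1)"

definition hamiltonian :: "nat \<Rightarrow> int \<Rightarrow> nat \<Rightarrow> nat \<Rightarrow> nat \<Rightarrow> real \<Rightarrow> config \<Rightarrow> real" where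
  "hamiltonian N c n m k \<alpha> \<sigma> =
     - (\<Sum>v\<in>strip_A N c n. real_of_int (\<sigma> v)) + (\<Sum>v\<in>strip_B N c n m k. real_of_int (\<sigma> v))
     - \<alpha> / 2 * (\<Sum>e\<in>E N. \<Prod>v\<in>e. real_of_int (\<sigma> v))"

definition is_path :: "nat \<Rightarrow> config list \<Rightarrow> bool" where
  "is_path N \<omega> \<longleftrightarrow> \<omega> \<noteq> [] \<and> set \<omega> \<subseteq> configs N \<and>
     successively (\<lambda>\<sigma> \<tau>. card {v \<in> V N. \<sigma> v \<noteq> \<tau> v} = 1) \<omega>"

definition paths :: "nat \<Rightarrow> config \<Rightarrow> config set \<Rightarrow> config list set" where
  "paths N \<eta> W = {\<omega>. is_path N \<omega> \<and> hd \<omega> = \<eta> \<and> last \<omega> \<in> W}"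

definition height :: "(config \<Rightarrow> real) \<Rightarrow> config list \<Rightarrow> real" where
  "height H \<omega> = Max (H ` set \<omega>)"

text \<open>There are infinitely many paths, but only finitely many heights, since \<open>configs N\<close> is
  finite.\<close>

definition comm_height :: "nat \<Rightarrow> (config \<Rightarrow> real) \<Rightarrow> config \<Rightarrow> config set \<Rightarrow> real" where
  "comm_height N H \<eta> W = Min (height H ` paths N \<eta> W)"

definition opt_paths :: "nat \<Rightarrow> (config \<Rightarrow> real) \<Rightarrow> config \<Rightarrow> config set \<Rightarrow> config list set" where
  "opt_paths N H \<eta> W = {\<omega> \<in> paths N \<eta> W. height H \<omega> = comm_height N H \<eta> W}"

text \<open>The rectangle of sites on the torus with \<open>w\<close> columns, \<open>h\<close> rows and lower left site
  \<open>(x, y)\<close>, coordinates taken modulo \<open>N\<close>.\<close>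

definition rectangle :: "nat \<Rightarrow> int \<Rightarrow> int \<Rightarrow> nat \<Rightarrow> nat \<Rightarrow> site set" where
  "rectangle N x y w h =
     {u \<in> V N. (fst u - x) mod int N < int w \<and> (snd u - y) mod int N < int h}"

text \<open>The bars of \<open>q\<close> sites that prolong \<open>rectangle N x y w h\<close> in the direction of its shortest
  side, in either direction if \<open>w = h\<close>. Such a bar is adjacent to a side that is orthogonal to the
  shortest one, and does not overhang it. ``Attached to the shortest side'' is read in this sense,
  not as abutting that side: a single site prolonging the shortest side of an \<open>\<alpha> \<times> (\<alpha> - 1)\<close>
  rectangle turns its bounding box into the \<open>\<alpha> \<times> \<alpha>\<close> square, which is the critical droplet,
  whereas a site abutting the shortest side gives an \<open>(\<alpha> + 1) \<times> (\<alpha> - 1)\<close> bounding box, and there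
  are optimal paths without such a configuration.\<close>

definition bars :: "nat \<Rightarrow> int \<Rightarrow> int \<Rightarrow> nat \<Rightarrow> nat \<Rightarrow> nat \<Rightarrow> site set set" where
  "bars N x y w h q =
     {rectangle N (x + int s) y' q 1 | s y'. h \<le> w \<and> s + q \<le> w \<and> y' \<in> {y - 1, y + int h}} \<union>
     {rectangle N x' (y + int s) 1 q | s x'. w \<le> h \<and> s + q \<le> h \<and> x' \<in> {x - 1, x + int w}}"

text \<open>Both orientations of the \<open>a \<times> b\<close> rectangle are allowed.\<close>

definition rect_bar :: "nat \<Rightarrow> site set \<Rightarrow> nat \<Rightarrow> nat \<Rightarrow> nat \<Rightarrow> site set set" where
  "rect_bar N S a b q =
     {rectangle N x y w h \<union> D | x y w h D.
        ((w, h) = (a, b) \<or> (w, h) = (b, a)) \<and> D \<in> bars N x y w h q} \<inter> Pow S"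

definition gate_A :: "nat \<Rightarrow> int \<Rightarrow> nat \<Rightarrow> nat \<Rightarrow> config set" where
  "gate_A N c n \<alpha> = set_config N ` rect_bar N (strip_A N c n) \<alpha> (\<alpha> - 1) 1"

definition gate_B :: "nat \<Rightarrow> int \<Rightarrow> nat \<Rightarrow> nat \<Rightarrow> nat \<Rightarrow> nat \<Rightarrow> config set" where
  "gate_B N c n m k \<alpha> =
     (\<lambda>R. set_config N (V N - R)) ` rect_bar N (strip_B N c n m k) \<alpha> (\<alpha> - 1) 1"

definition target :: "nat \<Rightarrow> int \<Rightarrow> nat \<Rightarrow> nat \<Rightarrow> config set" where
  "target N c n k = (\<Union>l\<in>{0..k}. \<Union>p\<in>{0..k}. {set_config N (strip_A_ext N c n l p)})"

end

theory Submission
  imports Defs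
begin

text \<open>Relative to the constant configuration, a droplet \<open>P\<close> has half energy
  \<open>\<alpha> p - |P \<inter> A| + |P \<inter> B|\<close>, where \<open>2 p\<close> is its perimeter. Filling \<open>A\<close> with height \<open>\<alpha>\<close> column by
  column and then row by row shows that an optimal path stays below the barrier
  \<open>\<alpha>\<^sup>2 + \<alpha> - 1\<close>. As \<open>p\<close> is at least the number of occupied rows and columns, a droplet of size
  \<open>\<alpha> (\<alpha> - 1)\<close> below the barrier is a quasi-square, and one of size between \<open>\<alpha> (\<alpha> - 1) + 1\<close> and
  \<open>\<alpha>\<^sup>2\<close> occupies exactly \<open>2 \<alpha>\<close> rows and columns, so that its bounding box is constant in time.
  The box must be the square when size \<open>\<alpha>\<^sup>2\<close> is reached, hence already when the site that
  completes \<open>\<alpha> (\<alpha> - 1) + 1\<close> is attached to the quasi-square, and then there is no energy left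
  for sites outside \<open>A\<close>. The second part is the first one with the signs and the roles of \<open>A\<close>
  and \<open>B\<close> exchanged.\<close>

section \<open>The torus\<close>

text \<open>The shift by 1 selects the representative of a residue class in
  \<open>{1..int N}\<close>, matching the coordinates of \<open>V N\<close>; a plain remainder would
  lie in \<open>{0..<int N}\<close>.\<close>

definition wrap :: "nat \<Rightarrow> int \<Rightarrow> int" where
  "wrap N x = (x - 1) mod int N + 1"

definition right :: "nat \<Rightarrow> site \<Rightarrow> site" where
  "right N u = (wrap N (fst u + 1), snd u)"

definition up :: "nat \<Rightarrow> site \<Rightarrow> site" where
  "up N u = (fst u, wrap N (snd u + 1))"

text \<open>On a cyclic line a set is left as often as it is entered, so the exits to the right and
  upwards together count half of the boundary edges.\<close>

definition exits :: "('a \<Rightarrow> 'a) \<Rightarrow> 'a set \<Rightarrow> 'a set" where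
  "exits f P = {u \<in> P. f u \<notin> P}"

lemma finite_V [simp]: "finite (V N)"
  by (simp add: V_def)

lemma finite_exits [simp]: "finite P \<Longrightarrow> finite (exits f P)"
  by (simp add: exits_def)

lemma exits_empty [simp]: "exits f {} = {}"
  by (simp add: exits_def)

lemma card_exits_insert_le:
  assumes "finite P"
  shows "card (exits f (insert v P)) \<le> card (exits f P) + 1"
proof -
  have "exits f (insert v P) \<subseteq> insert v (exits f P)" by (auto simp: exits_def)
  then have "card (exits f (insert v P)) \<le> card (insert v (exits f P))"
    using assms by (intro card_mono) auto
  also have "\<dots> \<le> card (exits f P) + 1" using card_insert_le_m1 by (simp add: card_insert_if assms)
  finally show ?thesis .
qed

text \<open>A predecessor of \<open>v\<close> in \<open>P\<close> is an exit of \<open>P\<close> and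
  ceases to be one, which makes up for \<open>v\<close> possibly becoming one.\<close>

lemma card_exits_insert_pred_le:
  assumes "finite P" "v \<notin> P" "v \<in> f ` P"
  shows "card (exits f (insert v P)) \<le> card (exits f P)"
proof -
  obtain w where "w \<in> P" "f w = v" using assms by blast
  then have w: "w \<in> exits f P" using assms by (auto simp: exits_def)
  have "exits f (insert v P) \<subseteq> insert v (exits f P - {w})" using assms \<open>f w = v\<close> by (auto simp: exits_def)
  then have "card (exits f (insert v P)) \<le> card (insert v (exits f P - {w}))"
    using assms by (intro card_mono) auto
  also have "\<dots> \<le> Suc (card (exits f P - {w}))" by (simp add: card_insert_if assms)
  also have "\<dots> = card (exits f P)" using w assms by (intro card_Suc_Diff1) auto
  finally show ?thesis .
qed

text \<open>As \<open>f\<close> permutes \<open>S\<close>, the set \<open>P\<close> and its preimage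
  have the same size; removing their common part leaves as many entries as exits.\<close>

lemma card_changes_eq_exits:
  assumes fin: "finite S" and bij: "bij_betw f S S" and P: "P \<subseteq> S"
  shows "card {u \<in> S. (u \<in> P) \<noteq> (f u \<in> P)} = 2 * card (exits f P)"
proof -
  let ?X = "{u \<in> P. f u \<in> P}" and ?Y = "{u \<in> S. u \<notin> P \<and> f u \<in> P}"
  have finP: "finite P" using fin P finite_subset by blast
  have "bij_betw f {u \<in> S. f u \<in> P} P"
    unfolding bij_betw_def
  proof
    show "inj_on f {u \<in> S. f u \<in> P}" using bij by (auto simp: bij_betw_def inj_on_def)
    have "f ` S = S" using bij by (simp add: bij_betw_def)
    then have "\<exists>u\<in>S. p = f u" if "p \<in> P" for p using that P by (metis imageE subsetD)
    then show "f ` {u \<in> S. f u \<in> P} = P" by (intro equalityI subsetI) (auto simp: image_iff Bex_def)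
  qed
  then have "card P = card {u \<in> S. f u \<in> P}" by (simp add: bij_betw_same_card)
  also have "{u \<in> S. f u \<in> P} = ?Y \<union> ?X" using P by auto
  also have "card \<dots> = card ?Y + card ?X" using fin finP by (intro card_Un_disjoint) auto
  finally have 1: "card P = card ?Y + card ?X" .
  have "exits f P \<union> ?X = P" by (auto simp: exits_def)
  then have "card P = card (exits f P \<union> ?X)" by (rule arg_cong[OF sym])
  also have "\<dots> = card (exits f P) + card ?X" using finP by (intro card_Un_disjoint) (auto simp: exits_def)
  finally have 2: "card ?Y = card (exits f P)" using 1 by simp
  have "{u \<in> S. (u \<in> P) \<noteq> (f u \<in> P)} = ?Y \<union> exits f P" using P by (auto simp: exits_def)
  also have "card \<dots> = card ?Y + card (exits f P)"
    using fin finP by (intro card_Un_disjoint) (auto simp: exits_def)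
  finally show ?thesis using 2 by simp
qed

lemma cong_add_mod_diff: "[s + (t - s) mod n = t] (mod n)" for s t n :: int
  by (simp add: cong_def mod_add_right_eq)

locale torus =
  fixes N :: nat
  assumes N_ge_3: "3 \<le> N"
begin

lemma wrap_mem [simp]: "wrap N x \<in> {1..int N}" "1 \<le> wrap N x" "wrap N x \<le> int N"
proof -
  have "0 \<le> (x - 1) mod int N" "(x - 1) mod int N < int N" using N_ge_3 by auto
  then show "1 \<le> wrap N x" "wrap N x \<le> int N" by (auto simp: wrap_def simp del: pos_mod_bound)
  then show "wrap N x \<in> {1..int N}" by simp
qed

lemma wrap_eq_iff: "wrap N x = wrap N y \<longleftrightarrow> [x = y] (mod int N)"
proof -
  have "wrap N x = wrap N y \<longleftrightarrow> [x + (-1) = y + (-1)] (mod int N)" by (simp add: wrap_def cong_def)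
  then show ?thesis using cong_add_rcancel by blast
qed

lemma wrap_ident: "x \<in> {1..int N} \<Longrightarrow> wrap N x = x"
  by (simp add: wrap_def)

lemma wrap_cong: "[wrap N x = x] (mod int N)"
  using wrap_eq_iff wrap_ident wrap_mem(1) by blast

lemma eq_wrap_iff: "x \<in> {1..int N} \<Longrightarrow> x = wrap N y \<longleftrightarrow> [x = y] (mod int N)"
  using wrap_eq_iff[of x y] wrap_ident[of x] by simp

lemma wrap_add [simp]:
  "wrap N (wrap N x + y) = wrap N (x + y)" "wrap N (y + wrap N x) = wrap N (y + x)"
  by (simp_all add: wrap_eq_iff wrap_cong cong_add_rcancel cong_add_lcancel)

lemma wrap_mod: "(wrap N x - y) mod int N = (x - y) mod int N"
  using wrap_cong[of x] cong_diff[OF wrap_cong cong_refl] unfolding cong_def by blast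

lemma wrap_neq: "0 < d \<Longrightarrow> d < int N \<Longrightarrow> wrap N (x + d) \<noteq> wrap N x"
  by (auto simp: wrap_eq_iff cong_iff_dvd_diff dest: zdvd_imp_le)

lemma right_neq: "u \<in> V N \<Longrightarrow> right N u \<noteq> u" "u \<in> V N \<Longrightarrow> right N (right N u) \<noteq> u"
  using wrap_neq[of 1 "fst u"] wrap_neq[of 2 "fst u"] N_ge_3 wrap_ident[of "fst u"]
  by (auto simp: right_def V_def ac_simps)

lemma up_neq: "u \<in> V N \<Longrightarrow> up N u \<noteq> u" "u \<in> V N \<Longrightarrow> up N (up N u) \<noteq> u"
  using wrap_neq[of 1 "snd u"] wrap_neq[of 2 "snd u"] N_ge_3 wrap_ident[of "snd u"]
  by (auto simp: up_def V_def ac_simps)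

lemma right_V: "u \<in> V N \<Longrightarrow> right N u \<in> V N"
  by (auto simp: right_def V_def)

lemma up_V: "u \<in> V N \<Longrightarrow> up N u \<in> V N"
  by (auto simp: up_def V_def)

lemma wrap_inj: "x \<in> {1..int N} \<Longrightarrow> y \<in> {1..int N} \<Longrightarrow> wrap N (x + d) = wrap N (y + d) \<Longrightarrow> x = y"
  using wrap_eq_iff cong_add_rcancel wrap_ident by metis

lemma bij_right: "bij_betw (right N) (V N) (V N)"
proof -
  have "inj_on (right N) (V N)" by (auto simp: inj_on_def right_def V_def intro: wrap_inj)
  then show ?thesis using right_V endo_inj_surj[of "V N" "right N"] by (simp add: bij_betw_def image_subset_iff)
qed

lemma bij_up: "bij_betw (up N) (V N) (V N)"
proof -
  have "inj_on (up N) (V N)" by (auto simp: inj_on_def up_def V_def intro: wrap_inj)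
  then show ?thesis using up_V endo_inj_surj[of "V N" "up N"] by (simp add: bij_betw_def image_subset_iff)
qed

lemma E_eq: "E N = (\<lambda>u. {u, right N u}) ` V N \<union> (\<lambda>u. {u, up N u}) ` V N"
proof -
  have 1: "[fst v = fst u + 1] (mod int N) \<and> snd v = snd u \<longleftrightarrow> v = right N u"
    if "u \<in> V N" "v \<in> V N" for u v
    using that eq_wrap_iff[of "fst v" "fst u + 1"] by (auto simp: right_def V_def prod_eq_iff)
  have 2: "fst v = fst u \<and> [snd v = snd u + 1] (mod int N) \<longleftrightarrow> v = up N u"
    if "u \<in> V N" "v \<in> V N" for u v
    using that eq_wrap_iff[of "snd v" "snd u + 1"] by (auto simp: up_def V_def prod_eq_iff)
  have "E N = {{u, v} | u v. u \<in> V N \<and> v \<in> V N \<and> (v = right N u \<or> v = up N u)}"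
    unfolding E_def using 1 2 by blast
  also have "\<dots> = (\<lambda>u. {u, right N u}) ` V N \<union> (\<lambda>u. {u, up N u}) ` V N"
    using right_V up_V by blast
  finally show ?thesis .
qed

lemma finite_E [simp]: "finite (E N)"
  by (simp add: E_eq)

text \<open>Every edge has a unique starting site, from which it leads right or up. Hence boundary
  edges correspond to the sites at which membership in \<open>P\<close> changes under
  \<open>right N\<close> or \<open>up N\<close>.\<close>

lemma card_edge_boundary:
  assumes P: "P \<subseteq> V N"
  shows "card {e \<in> E N. e \<inter> P \<noteq> {} \<and> \<not> e \<subseteq> P}
    = 2 * (card (exits (right N) P) + card (exits (up N) P))"
proof -
  let ?h = "\<lambda>u. {u, right N u}" and ?v = "\<lambda>u. {u, up N u}"
  let ?H = "{u \<in> V N. (u \<in> P) \<noteq> (right N u \<in> P)}" and ?U = "{u \<in> V N. (u \<in> P) \<noteq> (up N u \<in> P)}"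
  have "{e \<in> E N. e \<inter> P \<noteq> {} \<and> \<not> e \<subseteq> P} = ?h ` ?H \<union> ?v ` ?U"
    unfolding E_eq by (auto simp: image_iff)
  moreover have "?h ` ?H \<inter> ?v ` ?U = {}"
    using right_neq up_neq by (auto simp: doubleton_eq_iff right_def up_def)
  moreover have "inj_on ?h ?H"
    using right_neq(2) by (auto simp: inj_on_def doubleton_eq_iff)
  moreover have "inj_on ?v ?U"
    using up_neq(2) by (auto simp: inj_on_def doubleton_eq_iff)
  ultimately have "card {e \<in> E N. e \<inter> P \<noteq> {} \<and> \<not> e \<subseteq> P} = card ?H + card ?U"
    by (simp add: card_Un_disjoint card_image)
  then show ?thesis
    using card_changes_eq_exits[OF finite_V bij_right P] card_changes_eq_exits[OF finite_V bij_up P] by simp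
qed

section \<open>Cyclic intervals\<close>

text \<open>Applied to a row or column of a droplet, this says that an occupied line without an exit
  is full.\<close>

lemma cyclic_closed_UNIV:
  assumes "x \<in> S" "x \<in> {1..int N}" and closed: "\<And>z. z \<in> S \<Longrightarrow> wrap N (z + 1) \<in> S"
  shows "{1..int N} \<subseteq> S"
proof
  fix z assume z: "z \<in> {1..int N}"
  have step: "wrap N (x + int i) \<in> S" for i
  proof (induction i)
    case 0
    show ?case using assms wrap_ident[of x] by simp
  next
    case (Suc i)
    from closed[OF this] show ?case by (simp add: ac_simps)
  qed
  have "wrap N (x + int (nat ((z - x) mod int N))) = z"
  proof -
    have "[z = x + (z - x) mod int N] (mod int N)" using cong_add_mod_diff cong_sym by blast
    then have "z = wrap N (x + (z - x) mod int N)" using eq_wrap_iff[OF z] by blast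
    then show ?thesis using N_ge_3 by simp
  qed
  then show "z \<in> S" using step by metis
qed

text \<open>Read backwards from the only exit, membership in \<open>S\<close> is closed downwards.\<close>

lemma cyclic_interval:
  assumes S: "S \<subseteq> {1..int N}" "S \<noteq> {}"
    and unique: "\<And>x z. x \<in> S \<Longrightarrow> z \<in> S \<Longrightarrow> wrap N (x + 1) \<notin> S \<Longrightarrow> wrap N (z + 1) \<notin> S \<Longrightarrow> x = z"
  shows "\<exists>x. S = {z \<in> {1..int N}. (z - x) mod int N < int (card S)}"
proof (cases "\<exists>e\<in>S. wrap N (e + 1) \<notin> S")
  case False
  then have "S = {1..int N}" using cyclic_closed_UNIV S by blast
  then show ?thesis using N_ge_3 by (intro exI[of _ 0]) auto
next
  case True
  then obtain e where e: "e \<in> S" "wrap N (e + 1) \<notin> S" by blast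
  \<comment> \<open>Offsets read backwards from the exit \<open>e\<close>; the aim is that they form
    an initial segment of the naturals.\<close>
  define D where "D = {i. i < N \<and> wrap N (e - int i) \<in> S}"
  define L where "L = card S"
  have fin: "finite D" by (simp add: D_def)
  have down: "i \<in> D" if "Suc i \<in> D" for i
  proof -
    have *: "wrap N (e - int (Suc i)) \<in> S" "Suc i < N" using that by (auto simp: D_def)
    \<comment> \<open>A point at backward distance strictly between 0 and \<open>N\<close> from
      \<open>e\<close> differs from \<open>e\<close>. By uniqueness it is not an exit, so its
      successor lies in \<open>S\<close>.\<close>
    have "wrap N (wrap N (e - int (Suc i)) + int (Suc i)) \<noteq> wrap N (wrap N (e - int (Suc i)))"
      using wrap_neq[of "int (Suc i)" "wrap N (e - int (Suc i))"] * by simp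
    moreover have "wrap N (wrap N (e - int (Suc i)) + int (Suc i)) = wrap N e" by simp
    ultimately have "wrap N (e - int (Suc i)) \<noteq> e" by metis
    then have "wrap N (wrap N (e - int (Suc i)) + 1) \<in> S" using unique e * by blast
    then show ?thesis using * by (simp add: D_def)
  qed
  have down': "i \<in> D" if "j \<in> D" "i \<le> j" for i j
    using that(2,1) by (induction rule: inc_induct) (auto intro: down)
  have D_iff: "i \<in> D \<longleftrightarrow> i < card D" for i
  proof -
    define l where "l = (LEAST l. l \<notin> D)"
    have "\<exists>l. l \<notin> D" using fin ex_new_if_finite infinite_UNIV_nat by blast
    then have "l \<notin> D" unfolding l_def by (rule LeastI_ex)
    moreover have "i \<in> D" if "i < l" for i using that not_less_Least unfolding l_def by blast
    ultimately have "D = {..<l}" using down' by (auto simp: not_less[symmetric])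
    then show ?thesis by simp
  qed
  have mod_e: "wrap N (e - int (nat ((e - z) mod int N))) = z" if "z \<in> {1..int N}" for z
  proof -
    have "[e - (e - z) mod int N = e - (e - z)] (mod int N)"
      by (intro cong_diff cong_refl) simp
    then have "[z = e - (e - z) mod int N] (mod int N)" by (simp add: cong_sym_eq)
    then have "z = wrap N (e - (e - z) mod int N)" using eq_wrap_iff[OF that] by blast
    then show ?thesis using N_ge_3 by simp
  qed
  have lt: "nat ((e - z) mod int N) < N" for z using N_ge_3 by (simp add: nat_less_iff)
  have S_iff: "z \<in> S \<longleftrightarrow> nat ((e - z) mod int N) \<in> D" if "z \<in> {1..int N}" for z
    using mod_e[OF that] lt by (simp add: D_def)
  have "bij_betw (\<lambda>i. wrap N (e - int i)) D S"
    unfolding bij_betw_def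
  proof
    show "inj_on (\<lambda>i. wrap N (e - int i)) D"
    proof (rule linorder_inj_onI')
      fix i j assume "i \<in> D" "j \<in> D" "i < j"
      then show "wrap N (e - int i) \<noteq> wrap N (e - int j)"
        using wrap_neq[of "int j - int i" "e - int j"] by (auto simp: D_def)
    qed
    show "(\<lambda>i. wrap N (e - int i)) ` D = S"
    proof (intro equalityI subsetI)
      fix z assume z: "z \<in> S"
      then have z': "z \<in> {1..int N}" using S(1) by (rule subsetD[rotated])
      then have "nat ((e - z) mod int N) \<in> D" using S_iff z by iprover
      then show "z \<in> (\<lambda>i. wrap N (e - int i)) ` D"
        using mod_e[OF z'] by (metis image_eqI)
    qed (auto simp: D_def)
  qed
  then have card: "card D = L" unfolding L_def by (rule bij_betw_same_card)
  \<comment> \<open>Turns the interval around: the \<open>L\<close> points that end at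
    \<open>e\<close> are the \<open>L\<close> points that begin at \<open>e - L + 1\<close>.\<close>
  have 1: "(e - z) mod int N < int L \<longleftrightarrow> (z - (e - int L + 1)) mod int N < int L" for z
  proof -
    define d where "d = (e - z) mod int N"
    have d: "0 \<le> d" "d < int N" using N_ge_3 by (auto simp: d_def)
    have L: "L \<le> N" using card_mono[OF _ S(1)] by (simp add: L_def)
    have "(z - (e - int L + 1)) mod int N = (int L - 1 - (e - z)) mod int N" by (simp add: algebra_simps)
    also have "\<dots> = (int L - 1 - d) mod int N" by (simp add: d_def mod_diff_right_eq)
    also have "\<dots> = (if d < int L then int L - 1 - d else int L - 1 - d + int N)"
    proof (cases "d < int L")
      case False
      have "(int L - 1 - d) mod int N = (int L - 1 - d + int N) mod int N" by simp
      also have "\<dots> = int L - 1 - d + int N" using False d L by (intro mod_pos_pos_trivial) auto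
      finally show ?thesis using False by simp
    qed (use d L in simp)
    finally show ?thesis using d d_def by auto
  qed
  have 2: "z \<in> S \<longleftrightarrow> (e - z) mod int N < int L" if "z \<in> {1..int N}" for z
    unfolding S_iff[OF that] D_iff card using N_ge_3 by (simp add: nat_less_iff)
  have "S = {z \<in> {1..int N}. (z - (e - int L + 1)) mod int N < int (card S)}"
    unfolding L_def[symmetric]
  proof (intro equalityI subsetI CollectI conjI)
    fix z assume "z \<in> S"
    then show z: "z \<in> {1..int N}" using S(1) by (rule subsetD[rotated])
    show "(z - (e - int L + 1)) mod int N < int L" using 1[of z] 2[OF z] \<open>z \<in> S\<close> by iprover
  next
    fix z assume "z \<in> {z \<in> {1..int N}. (z - (e - int L + 1)) mod int N < int L}"
    then show "z \<in> S" using 1[of z] 2[of z] by simp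
  qed
  then show ?thesis by (rule exI)
qed

text \<open>If \<open>y\<close> touched neither end of \<open>Y\<close>, then both \<open>y\<close>
  and the last point of \<open>Y\<close> would be exits of \<open>insert y Y\<close>.\<close>

lemma adjacent_to_cyclic_interval:
  assumes Y: "Y = {z \<in> {1..int N}. (z - y0) mod int N < int l}" and l: "1 \<le> l" "l < N"
    and y: "y \<in> {1..int N}" "y \<notin> Y"
    and unique: "\<And>x z. x \<in> insert y Y \<Longrightarrow> z \<in> insert y Y \<Longrightarrow>
      wrap N (x + 1) \<notin> insert y Y \<Longrightarrow> wrap N (z + 1) \<notin> insert y Y \<Longrightarrow> x = z"
  shows "[y = y0 - 1] (mod int N) \<or> [y = y0 + int l] (mod int N)"
proof (rule ccontr)
  assume *: "\<not> ?thesis"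
  define e where "e = wrap N (y0 + int l - 1)"
  have eY: "e \<in> Y" using l by (simp add: Y e_def wrap_mod algebra_simps)
  have "wrap N (e + 1) = wrap N (y0 + int l)" by (simp add: e_def)
  moreover have "wrap N (y0 + int l) \<notin> Y" using l by (simp add: Y wrap_mod)
  moreover have "wrap N (y0 + int l) \<noteq> y" using * wrap_cong cong_sym by blast
  ultimately have e1: "wrap N (e + 1) \<notin> insert y Y" by simp
  have "wrap N (y + 1) \<notin> Y"
  proof
    assume "wrap N (y + 1) \<in> Y"
    then have d: "(y + 1 - y0) mod int N < int l" by (simp add: Y wrap_mod)
    have "(y + 1 - y0) mod int N \<noteq> 0" using * by (simp add: cong_iff_dvd_diff dvd_eq_mod_eq_0 algebra_simps)
    then have "0 \<le> (y + 1 - y0) mod int N - 1" using N_ge_3 pos_mod_sign[of "int N" "y + 1 - y0"] by linarith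
    moreover have "(y - y0) mod int N = ((y + 1 - y0) mod int N - 1) mod int N"
      by (simp add: mod_diff_left_eq)
    ultimately have "(y - y0) mod int N = (y + 1 - y0) mod int N - 1"
      using d l by simp
    then show False using y d by (simp add: Y)
  qed
  moreover have "wrap N (y + 1) \<noteq> y" using wrap_neq[of 1 y] wrap_ident[of y] y N_ge_3 by simp
  ultimately have "wrap N (y + 1) \<notin> insert y Y" by simp
  then have "e = y" using unique eY e1 by blast
  then show False using eY y by blast
qed

section \<open>Isoperimetry\<close>

text \<open>Lines closed around the torus have no exit; they alone can make the occupied lines
  outnumber the exits.\<close>

definition full_rows :: "site set \<Rightarrow> int set" where
  "full_rows P = {y \<in> {1..int N}. {1..int N} \<times> {y} \<subseteq> P}"

definition full_cols :: "site set \<Rightarrow> int set" where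
  "full_cols P = {x \<in> {1..int N}. {x} \<times> {1..int N} \<subseteq> P}"

lemma rows_subset:
  assumes P: "P \<subseteq> V N"
  shows "snd ` P \<subseteq> snd ` exits (right N) P \<union> full_rows P"
proof
  fix y assume "y \<in> snd ` P"
  then obtain x where x: "(x, y) \<in> P" by auto
  then have xy: "x \<in> {1..int N}" "y \<in> {1..int N}" using P by (auto simp: V_def)
  show "y \<in> snd ` exits (right N) P \<union> full_rows P"
  proof (cases "\<exists>z. (z, y) \<in> exits (right N) P")
    case True
    then show ?thesis by force
  next
    case False
    then have "{1..int N} \<subseteq> {x. (x, y) \<in> P}"
      using x xy by (intro cyclic_closed_UNIV[of x]) (auto simp: exits_def right_def)
    then show ?thesis using xy by (auto simp: full_rows_def)
  qed
qed

lemma cols_subset: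
  assumes P: "P \<subseteq> V N"
  shows "fst ` P \<subseteq> fst ` exits (up N) P \<union> full_cols P"
proof
  fix x assume "x \<in> fst ` P"
  then obtain y where y: "(x, y) \<in> P" by auto
  then have xy: "x \<in> {1..int N}" "y \<in> {1..int N}" using P by (auto simp: V_def)
  show "x \<in> fst ` exits (up N) P \<union> full_cols P"
  proof (cases "\<exists>z. (x, z) \<in> exits (up N) P")
    case True
    then show ?thesis by force
  next
    case False
    then have "{1..int N} \<subseteq> {y. (x, y) \<in> P}"
      using y xy by (intro cyclic_closed_UNIV[of y]) (auto simp: exits_def up_def)
    then show ?thesis using xy by (auto simp: full_cols_def)
  qed
qed

lemma finite_full [simp]: "finite (full_rows P)" "finite (full_cols P)"
  unfolding full_rows_def full_cols_def by (rule finite_subset[of _ "{1..int N}"]; auto)+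

lemma finite_subset_V: "P \<subseteq> V N \<Longrightarrow> finite P"
  using finite_V finite_subset by blast

lemma card_rows_le:
  assumes "P \<subseteq> V N"
  shows "card (snd ` P) \<le> card (exits (right N) P) + card (full_rows P)"
proof -
  have fin: "finite P" using assms by (rule finite_subset_V)
  have "card (snd ` P) \<le> card (snd ` exits (right N) P \<union> full_rows P)"
    using fin rows_subset[OF assms] by (intro card_mono) auto
  also have "\<dots> \<le> card (snd ` exits (right N) P) + card (full_rows P)" by (rule card_Un_le)
  also have "\<dots> \<le> card (exits (right N) P) + card (full_rows P)" using fin by (simp add: card_image_le)
  finally show ?thesis .
qed

lemma card_cols_le:
  assumes "P \<subseteq> V N"
  shows "card (fst ` P) \<le> card (exits (up N) P) + card (full_cols P)"
proof -
  have fin: "finite P" using assms by (rule finite_subset_V)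
  have "card (fst ` P) \<le> card (fst ` exits (up N) P \<union> full_cols P)"
    using fin cols_subset[OF assms] by (intro card_mono) auto
  also have "\<dots> \<le> card (fst ` exits (up N) P) + card (full_cols P)" by (rule card_Un_le)
  also have "\<dots> \<le> card (exits (up N) P) + card (full_cols P)" using fin by (simp add: card_image_le)
  finally show ?thesis .
qed

lemma card_full_rows_le:
  assumes "P \<subseteq> V N"
  shows "N * card (full_rows P) \<le> card P"
proof -
  have "card ({1..int N} \<times> full_rows P) \<le> card P"
    using finite_subset_V[OF assms] by (intro card_mono) (auto simp: full_rows_def)
  then show ?thesis by (simp add: card_cartesian_product)
qed

lemma card_full_cols_le:
  assumes "P \<subseteq> V N"
  shows "N * card (full_cols P) \<le> card P"
proof -
  have "card (full_cols P \<times> {1..int N}) \<le> card P"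
    using finite_subset_V[OF assms] by (intro card_mono) (auto simp: full_cols_def)
  then show ?thesis by (simp add: card_cartesian_product mult.commute)
qed

lemma card_cols_full_row: "P \<subseteq> V N \<Longrightarrow> full_rows P \<noteq> {} \<Longrightarrow> card (fst ` P) = N"
proof -
  assume P: "P \<subseteq> V N" and "full_rows P \<noteq> {}"
  then obtain y where "{1..int N} \<times> {y} \<subseteq> P" by (auto simp: full_rows_def)
  then have "{1..int N} \<subseteq> fst ` P" by force
  moreover have "fst ` P \<subseteq> {1..int N}" using P by (auto simp: V_def)
  ultimately have "fst ` P = {1..int N}" by blast
  then show "card (fst ` P) = N" by simp
qed

lemma card_rows_full_col: "P \<subseteq> V N \<Longrightarrow> full_cols P \<noteq> {} \<Longrightarrow> card (snd ` P) = N"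
proof -
  assume P: "P \<subseteq> V N" and "full_cols P \<noteq> {}"
  then obtain x where "{x} \<times> {1..int N} \<subseteq> P" by (auto simp: full_cols_def)
  then have "{1..int N} \<subseteq> snd ` P" by force
  moreover have "snd ` P \<subseteq> {1..int N}" using P by (auto simp: V_def)
  ultimately have "snd ` P = {1..int N}" by blast
  then show "card (snd ` P) = N" by simp
qed

text \<open>By area there are fewer than \<open>a\<close> full rows and fewer than \<open>a\<close>
  full columns. A full row occupies all \<open>N > 2 * a\<close> columns, more than there are exits,
  so some column is full as well, and conversely. If both occurred, \<open>2 * N\<close> would be at
  most the exits plus the full lines, hence less than \<open>4 * a\<close>.\<close>

lemma no_full_lines:
  assumes P: "P \<subseteq> V N" and a: "0 < a" "2 * a < N" and "card P \<le> a * a"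
    and p: "card (exits (right N) P) + card (exits (up N) P) \<le> 2 * a"
  shows "full_rows P = {}" "full_cols P = {}"
proof -
  have lt: "f < a" if "N * f \<le> card P" for f
  proof (rule ccontr)
    assume "\<not> f < a"
    then have "N * a \<le> N * f" by simp
    moreover have "a * a < N * a" using a by simp
    ultimately show False using that assms(4) by linarith
  qed
  have r: "card (full_rows P) < a" using lt card_full_rows_le[OF P] by blast
  have c: "card (full_cols P) < a" using lt card_full_cols_le[OF P] by blast
  have R: "N \<le> card (exits (up N) P) + card (full_cols P)" if "full_rows P \<noteq> {}"
    using card_cols_full_row[OF P that] card_cols_le[OF P] by simp
  have C: "N \<le> card (exits (right N) P) + card (full_rows P)" if "full_cols P \<noteq> {}"
    using card_rows_full_col[OF P that] card_rows_le[OF P] by simp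
  have 1: "full_cols P \<noteq> {}" if "full_rows P \<noteq> {}"
    using R[OF that] p a by (cases "full_cols P = {}") auto
  have 2: "full_rows P \<noteq> {}" if "full_cols P \<noteq> {}"
    using C[OF that] p a by (cases "full_rows P = {}") auto
  have "\<not> (full_rows P \<noteq> {} \<and> full_cols P \<noteq> {})"
    using R C r c p a by linarith
  then show "full_rows P = {}" "full_cols P = {}" using 1 2 by blast+
qed

text \<open>Without full rows every occupied row has an exit; if there are no more exits than rows,
  each row has exactly one. This is the form in which convexity of the rows is used.\<close>

lemma inj_on_snd_exits:
  assumes P: "P \<subseteq> V N" and "full_rows P = {}" and "card (exits (right N) P) \<le> card (snd ` P)"
  shows "inj_on snd (exits (right N) P)"
proof -
  have fin: "finite P" using P by (rule finite_subset_V)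
  have "card (snd ` P) \<le> card (snd ` exits (right N) P)"
    using rows_subset[OF P] assms(2) fin by (intro card_mono) auto
  moreover have "card (snd ` exits (right N) P) \<le> card (exits (right N) P)"
    using fin by (simp add: card_image_le)
  ultimately show ?thesis using assms(3) fin by (intro eq_card_imp_inj_on) auto
qed

lemma inj_on_fst_exits:
  assumes P: "P \<subseteq> V N" and "full_cols P = {}" and "card (exits (up N) P) \<le> card (fst ` P)"
  shows "inj_on fst (exits (up N) P)"
proof -
  have fin: "finite P" using P by (rule finite_subset_V)
  have "card (fst ` P) \<le> card (fst ` exits (up N) P)"
    using cols_subset[OF P] assms(2) fin by (intro card_mono) auto
  moreover have "card (fst ` exits (up N) P) \<le> card (exits (up N) P)"
    using fin by (simp add: card_image_le)
  ultimately show ?thesis using assms(3) fin by (intro eq_card_imp_inj_on) auto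
qed

end

section \<open>Sides and area of a bounding box\<close>

lemma card_le_cols_times_rows:
  assumes "finite P"
  shows "card P \<le> card (fst ` P) * card (snd ` P)"
proof -
  have "card P \<le> card (fst ` P \<times> snd ` P)"
    using assms subset_fst_snd by (intro card_mono) auto
  then show ?thesis by (simp add: card_cartesian_product)
qed

lemma product_if_card:
  assumes "finite P" "card P = card (fst ` P) * card (snd ` P)"
  shows "P = fst ` P \<times> snd ` P"
  using assms subset_fst_snd by (intro card_subset_eq) (auto simp: card_cartesian_product)

lemma four_mult_eq: "4 * (int r * int c) = (int r + int c)\<^sup>2 - (int r - int c)\<^sup>2"
  by (simp add: power2_eq_square algebra_simps)

text \<open>From \<open>4 r c <= (2 a - 1)^2 = 4 a (a - 1) + 1\<close>, where the 1 is lost by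
  integrality. The computation is in the integers to avoid truncated subtraction.\<close>

lemma mult_le_if_sum_less:
  fixes r c a :: nat
  assumes "r + c < 2 * a"
  shows "r * c \<le> a * (a - 1)"
proof -
  have "(int r + int c)\<^sup>2 \<le> (2 * int a - 1)\<^sup>2" using assms by (intro power_mono) auto
  also have "\<dots> = 4 * (int a * (int a - 1)) + 1" by (simp add: power2_eq_square algebra_simps)
  finally have "int r * int c \<le> int a * (int a - 1)" using four_mult_eq[of r c] zero_le_power2[of "int r - int c"] by linarith
  moreover have "int (a * (a - 1)) = int a * (int a - 1)" using assms by (simp add: of_nat_diff)
  ultimately show ?thesis by (metis of_nat_le_iff of_nat_mult)
qed

text \<open>A sum of at most \<open>2 a - 2\<close> would give an area of at most
  \<open>(a - 1)^2\<close>, which is too small. So the sum is \<open>2 a - 1\<close>, and then the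
  area forces \<open>(r - c)^2 <= 1\<close>.\<close>

lemma quasi_square_sides:
  fixes r c a :: nat
  assumes a: "2 \<le> a" and "r + c < 2 * a" "a * (a - 1) \<le> r * c"
  shows "r = a \<and> c = a - 1 \<or> r = a - 1 \<and> c = a"
proof -
  have "int (a * (a - 1)) = int a * (int a - 1)" using a by (simp add: of_nat_diff)
  then have ge: "int a * (int a - 1) \<le> int r * int c" using assms(3) by (metis of_nat_le_iff of_nat_mult)
  have sum: "int r + int c = 2 * int a - 1"
  proof (rule ccontr)
    assume "\<not> ?thesis"
    then have "(int r + int c)\<^sup>2 \<le> (2 * int a - 2)\<^sup>2" using assms by (intro power_mono) auto
    also have "\<dots> = 4 * (int a * (int a - 1)) - 4 * int a + 4" by (simp add: power2_eq_square algebra_simps)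
    finally show False using four_mult_eq[of r c] ge a zero_le_power2[of "int r - int c"] by linarith
  qed
  have "(int r + int c)\<^sup>2 = 4 * (int a * (int a - 1)) + 1"
    unfolding sum by (simp add: power2_eq_square algebra_simps)
  then have "(int r - int c)\<^sup>2 \<le> 1\<^sup>2" using four_mult_eq[of r c] ge by simp
  then have "\<bar>int r - int c\<bar> \<le> 1" using abs_le_square_iff[of "int r - int c" 1] by simp
  then show ?thesis using sum a by arith
qed

text \<open>The equality case of the arithmetic-geometric mean inequality: no room is left for
  \<open>(r - c)^2\<close>.\<close>

lemma square_sides:
  fixes r c a :: nat
  assumes "r + c \<le> 2 * a" "a * a \<le> r * c"
  shows "r = a"
proof -
  have "(int r + int c)\<^sup>2 \<le> (2 * int a)\<^sup>2" using assms by (intro power_mono) auto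
  also have "\<dots> = 4 * int (a * a)" by (simp add: power2_eq_square)
  also have "\<dots> \<le> 4 * (int r * int c)" using assms(2) by (metis mult_left_mono of_nat_le_iff of_nat_mult zero_le_numeral)
  finally have "(int r - int c)\<^sup>2 \<le> 0" using four_mult_eq[of r c] by linarith
  then have rc: "r = c" by simp
  then have "a \<le> r" using assms(2) by (meson mult_strict_mono' not_le zero_le)
  then show ?thesis using rc assms(1) by simp
qed

section \<open>Energies\<close>

text \<open>Half of the energy of the droplet \<open>P\<close> relative to the constant configuration, where \<open>A\<close>
  is the region that favours the droplet and \<open>B\<close> the one that opposes it.\<close>

definition half_energy :: "nat \<Rightarrow> nat \<Rightarrow> site set \<Rightarrow> site set \<Rightarrow> site set \<Rightarrow> int" where
  "half_energy N a A B P =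
     int a * int (card (exits (right N) P) + card (exits (up N) P)) - int (card (P \<inter> A)) + int (card (P \<inter> B))"

text \<open>The half energy of the critical droplet inside \<open>A\<close>: its bounding box is the
  square of side \<open>a\<close> and its size is \<open>a (a - 1) + 1\<close>, which gives
  \<open>2 a^2 - (a (a - 1) + 1)\<close>.\<close>

definition barrier :: "nat \<Rightarrow> int" where
  "barrier a = int a * int a + int a - 1"

context torus
begin

text \<open>At most \<open>card P\<close> energy is gained in \<open>A\<close>, so the perimeter
  term is at most \<open>barrier a + a (a - 1) = 2 a^2 - 1\<close>.\<close>

lemma perimeter_less_if_card_le:
  assumes P: "finite P" and e: "half_energy N a A B P \<le> barrier a" and a: "0 < a"
    and c: "card P \<le> a * (a - 1)"
  shows "card (exits (right N) P) + card (exits (up N) P) < 2 * a"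
proof -
  let ?p = "card (exits (right N) P) + card (exits (up N) P)"
  have "int (card (P \<inter> A)) \<le> int (card P)" using P by (simp add: card_mono)
  then have "int a * int ?p \<le> barrier a + int (card P)" using e by (simp add: half_energy_def)
  also have "int (card P) \<le> int a * (int a - 1)"
    using c a by (metis Suc_diff_1 int_ops(2) of_nat_diff of_nat_le_iff of_nat_mult One_nat_def Suc_leI)
  finally have "int a * int ?p < int a * (2 * int a)" by (simp add: barrier_def algebra_simps)
  then show ?thesis using a by simp
qed

text \<open>Here the same estimate gives \<open>2 a^2 + a - 1\<close>, just short of
  \<open>a (2 a + 1)\<close>.\<close>

lemma perimeter_le_if_card_le:
  assumes P: "finite P" and e: "half_energy N a A B P \<le> barrier a" and a: "0 < a"
    and c: "card P \<le> a * a"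
  shows "card (exits (right N) P) + card (exits (up N) P) \<le> 2 * a"
proof -
  let ?p = "card (exits (right N) P) + card (exits (up N) P)"
  have "int (card (P \<inter> A)) \<le> int (card P)" using P by (simp add: card_mono)
  then have "int a * int ?p \<le> barrier a + int (card P)" using e by (simp add: half_energy_def)
  also have "int (card P) \<le> int a * int a" using c by (metis of_nat_le_iff of_nat_mult)
  finally have "int a * int ?p < int a * (2 * int a + 1)" by (simp add: barrier_def algebra_simps)
  then show ?thesis using a by simp
qed

lemma sides_le_perimeter:
  assumes P: "P \<subseteq> V N" and e: "half_energy N a A B P \<le> barrier a" and a: "0 < a" "2 * a < N"
    and c: "card P \<le> a * a"
  shows "card (snd ` P) \<le> card (exits (right N) P)" "card (fst ` P) \<le> card (exits (up N) P)"
  using card_rows_le[OF P] card_cols_le[OF P]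
    no_full_lines[OF P a c perimeter_le_if_card_le[OF finite_subset_V[OF P] e a(1) c]] by auto

text \<open>The energy bounds the exits, and with them the sides, by \<open>2 a\<close> in total,
  while a smaller sum of sides would leave room for only \<open>a (a - 1)\<close> sites. The squeeze
  also leaves one exit per occupied line.\<close>

lemma sides_sum:
  assumes P: "P \<subseteq> V N" and e: "half_energy N a A B P \<le> barrier a" and a: "0 < a" "2 * a < N"
    and c: "a * (a - 1) < card P" "card P \<le> a * a"
  shows "card (fst ` P) + card (snd ` P) = 2 * a"
    "card (exits (right N) P) = card (snd ` P)" "card (exits (up N) P) = card (fst ` P)"
proof -
  have fin: "finite P" using P by (rule finite_subset_V)
  note le = sides_le_perimeter[OF P e a c(2)] perimeter_le_if_card_le[OF fin e a(1) c(2)]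
  have "\<not> card (fst ` P) + card (snd ` P) < 2 * a"
    using mult_le_if_sum_less card_le_cols_times_rows[OF fin] c by (meson not_le order_trans)
  then show "card (fst ` P) + card (snd ` P) = 2 * a"
    "card (exits (right N) P) = card (snd ` P)" "card (exits (up N) P) = card (fst ` P)"
    using le by linarith+
qed

section \<open>Rectangles and bars as sets of sites\<close>

lemma rectangle_singleton:
  assumes "v \<in> V N" "[x = fst v] (mod int N)" "[y = snd v] (mod int N)"
  shows "rectangle N x y 1 1 = {v}"
proof -
  have *: "(s - z) mod int N < 1 \<longleftrightarrow> s = t"
    if "[z = t] (mod int N)" "s \<in> {1..int N}" "t \<in> {1..int N}" for s t z
  proof -
    have "(s - z) mod int N < 1 \<longleftrightarrow> (s - z) mod int N = 0"
      using N_ge_3 pos_mod_sign[of "int N" "s - z"] by linarith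
    also have "\<dots> \<longleftrightarrow> [s = z] (mod int N)" by (simp add: cong_iff_dvd_diff dvd_eq_mod_eq_0)
    also have "\<dots> \<longleftrightarrow> [s = t] (mod int N)" using that(1) cong_sym cong_trans by blast
    also have "\<dots> \<longleftrightarrow> s = t" using that eq_wrap_iff[of s t] wrap_ident[of t] by simp
    finally show ?thesis .
  qed
  show ?thesis using assms * by (auto simp: rectangle_def V_def prod_eq_iff)
qed

lemma rectangle_eq_product:
  assumes "X = {z \<in> {1..int N}. (z - x0) mod int N < int w}"
    and "Y = {z \<in> {1..int N}. (z - y0) mod int N < int h}"
  shows "X \<times> Y = rectangle N x0 y0 w h"
  using assms by (auto simp: rectangle_def V_def)

lemma singleton_mem_bars:
  assumes v: "v \<in> V N"
    and "h \<le> w \<and> (fst v - x) mod int N < int w \<and>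
        ([snd v = y - 1] (mod int N) \<or> [snd v = y + int h] (mod int N)) \<or>
      w \<le> h \<and> (snd v - y) mod int N < int h \<and>
        ([fst v = x - 1] (mod int N) \<or> [fst v = x + int w] (mod int N))"
  shows "{v} \<in> bars N x y w h 1"
proof -
  have shift: "[z + int (nat ((t - z) mod int N)) = t] (mod int N)" for z t
    using N_ge_3 cong_add_mod_diff[of z t "int N"] by simp
  \<comment> \<open>The offset of \<open>v\<close> along the side serves as \<open>s\<close>; a bar
    of length 1 at this offset does not overhang.\<close>
  have nat_le: "nat (d mod int N) + 1 \<le> w" if "d mod int N < int w" for d and w :: nat
    using that N_ge_3 pos_mod_sign[of "int N" d] by linarith
  show ?thesis using assms(2)
  proof (elim disjE conjE)
    assume *: "h \<le> w" "(fst v - x) mod int N < int w"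
    have "{v} \<in> bars N x y w h 1" if "[y' = snd v] (mod int N)" "y' \<in> {y - 1, y + int h}" for y'
      using rectangle_singleton[OF v shift that(1)] *(1) nat_le[OF *(2)] that(2)
      unfolding bars_def by blast
    then show "[snd v = y - 1] (mod int N) \<Longrightarrow> ?thesis" "[snd v = y + int h] (mod int N) \<Longrightarrow> ?thesis"
      by (auto dest: cong_sym)
  next
    assume *: "w \<le> h" "(snd v - y) mod int N < int h"
    have "{v} \<in> bars N x y w h 1" if "[x' = fst v] (mod int N)" "x' \<in> {x - 1, x + int w}" for x'
      using rectangle_singleton[OF v that(1) shift] *(1) nat_le[OF *(2)] that(2)
      unfolding bars_def by blast
    then show "[fst v = x - 1] (mod int N) \<Longrightarrow> ?thesis" "[fst v = x + int w] (mod int N) \<Longrightarrow> ?thesis"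
      by (auto dest: cong_sym)
  qed
qed

section \<open>Quasi-squares and critical droplets\<close>

lemma row_unique_exit:
  assumes "inj_on snd (exits (right N) P)"
    and "(x, y) \<in> P" "(z, y) \<in> P" "(wrap N (x + 1), y) \<notin> P" "(wrap N (z + 1), y) \<notin> P"
  shows "x = z"
proof -
  have "(x, y) \<in> exits (right N) P" "(z, y) \<in> exits (right N) P"
    using assms(2-) by (auto simp: exits_def right_def)
  then show ?thesis using inj_onD[OF assms(1), of "(x, y)" "(z, y)"] by simp
qed

lemma col_unique_exit:
  assumes "inj_on fst (exits (up N) P)"
    and "(x, y) \<in> P" "(x, z) \<in> P" "(x, wrap N (y + 1)) \<notin> P" "(x, wrap N (z + 1)) \<notin> P"
  shows "y = z"
proof -
  have "(x, y) \<in> exits (up N) P" "(x, z) \<in> exits (up N) P"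
    using assms(2-) by (auto simp: exits_def up_def)
  then show ?thesis using inj_onD[OF assms(1), of "(x, y)" "(x, z)"] by simp
qed

text \<open>Perimeter and area force the sides \<open>a\<close> and \<open>a - 1\<close>, so
  \<open>P\<close> fills its bounding box. Having one exit per line, both projections are cyclic
  intervals.\<close>

lemma quasi_square_is_rectangle:
  assumes P: "P \<subseteq> V N" and e: "half_energy N a A B P \<le> barrier a" and a: "2 \<le> a" "2 * a < N"
    and c: "card P = a * (a - 1)"
  obtains X Y x y w h where "P = X \<times> Y" "X \<noteq> {}" "Y \<noteq> {}"
    "X = {z \<in> {1..int N}. (z - x) mod int N < int w}"
    "Y = {z \<in> {1..int N}. (z - y) mod int N < int h}"
    "card X = w" "card Y = h" "w = a \<and> h = a - 1 \<or> w = a - 1 \<and> h = a"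
proof -
  have fin: "finite P" using P by (rule finite_subset_V)
  have a0: "0 < a" using a by simp
  have c': "card P \<le> a * a" using c by simp
  let ?X = "fst ` P" and ?Y = "snd ` P"
  note le = sides_le_perimeter[OF P e a0 a(2) c'] perimeter_less_if_card_le[OF fin e a0 c[THEN eq_refl]]
  have sum: "card ?X + card ?Y < 2 * a" using le by linarith
  have sides: "card ?X = a \<and> card ?Y = a - 1 \<or> card ?X = a - 1 \<and> card ?Y = a"
    using quasi_square_sides[OF a(1) sum] card_le_cols_times_rows[OF fin] c by simp
  then have "card P = card ?X * card ?Y" using c by auto
  then have prod: "P = ?X \<times> ?Y" using product_if_card[OF fin] by blast
  \<comment> \<open>The sides already add up to \<open>2 a - 1\<close>, so neither kind of exit can
    exceed its side.\<close>
  have ex: "card (exits (right N) P) \<le> card ?Y" "card (exits (up N) P) \<le> card ?X"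
    using le sides a by linarith+
  note nofull = no_full_lines[OF P a0 a(2) c' less_imp_le[OF le(3)]]
  have inj: "inj_on snd (exits (right N) P)" "inj_on fst (exits (up N) P)"
    using inj_on_snd_exits[OF P nofull(1) ex(1)] inj_on_fst_exits[OF P nofull(2) ex(2)] by auto
  have ne: "P \<noteq> {}" using c a by auto
  \<comment> \<open>In a product all rows look alike, and so do all columns: the row
    \<open>y0\<close> and the column \<open>x0\<close> suffice to read off the exits of the two
    projections.\<close>
  then obtain x0 y0 where xy: "x0 \<in> ?X" "y0 \<in> ?Y" by auto
  have mem: "(x, y) \<in> P \<longleftrightarrow> x \<in> ?X \<and> y \<in> ?Y" for x y by (subst prod) simp
  have X: "\<exists>x. ?X = {z \<in> {1..int N}. (z - x) mod int N < int (card ?X)}"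
  proof (rule cyclic_interval)
    show "?X \<subseteq> {1..int N}" using P by (auto simp: V_def)
    show "?X \<noteq> {}" using ne by simp
    show "x = z" if "x \<in> ?X" "z \<in> ?X" "wrap N (x + 1) \<notin> ?X" "wrap N (z + 1) \<notin> ?X" for x z
      using row_unique_exit[OF inj(1), of x y0 z] that xy(2) unfolding mem by blast
  qed
  have Y: "\<exists>y. ?Y = {z \<in> {1..int N}. (z - y) mod int N < int (card ?Y)}"
  proof (rule cyclic_interval)
    show "?Y \<subseteq> {1..int N}" using P by (auto simp: V_def)
    show "?Y \<noteq> {}" using ne by simp
    show "x = z" if "x \<in> ?Y" "z \<in> ?Y" "wrap N (x + 1) \<notin> ?Y" "wrap N (z + 1) \<notin> ?Y" for x z
      using col_unique_exit[OF inj(2), of x0 x z] that xy(1) unfolding mem by blast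
  qed
  have ne': "?X \<noteq> {}" "?Y \<noteq> {}" using ne by auto
  from X obtain x where x: "?X = {z \<in> {1..int N}. (z - x) mod int N < int (card ?X)}" by (rule exE)
  from Y obtain y where y: "?Y = {z \<in> {1..int N}. (z - y) mod int N < int (card ?Y)}" by (rule exE)
  show ?thesis by (rule that[OF prod ne' x y refl refl sides])
qed

text \<open>The assumption \<open>box\<close> makes the bounding box of \<open>insert v P\<close>
  the square of side \<open>a\<close>, so \<open>v\<close> must prolong the short side of the
  quasi-square.\<close>

lemma critical_droplet:
  assumes P: "P \<subseteq> V N" and v: "v \<in> V N" "v \<notin> P"
    and e: "half_energy N a A B P \<le> barrier a" "half_energy N a A B (insert v P) \<le> barrier a"
    and a: "2 \<le> a" "2 * a < N" and c: "card P = a * (a - 1)" and box: "card (fst ` insert v P) = a"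
  shows "insert v P \<in> rect_bar N A a (a - 1) 1"
proof -
  have fin: "finite P" using P by (rule finite_subset_V)
  have a0: "0 < a" using a by simp
  let ?Q = "insert v P"
  have Q: "?Q \<subseteq> V N" using P v by simp
  have cQ: "card ?Q = a * (a - 1) + 1" using c v fin by simp
  have cQ': "a * (a - 1) < card ?Q" "card ?Q \<le> a * a"
  proof -
    have "a * (a - 1) + a = a * a" using a by (simp add: algebra_simps)
    then show "card ?Q \<le> a * a" using cQ a by linarith
  qed (use cQ in simp)
  note sum = sides_sum[OF Q e(2) a0 a(2) cQ']
  have rows: "card (snd ` ?Q) = a" using sum box by simp
  have QA: "?Q \<subseteq> A"
  proof -
    \<comment> \<open>With perimeter term \<open>2 a^2\<close>, the barrier demands at least
      \<open>a^2 - a + 1\<close> sites in \<open>A\<close>, which is the whole size of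
      \<open>?Q\<close>.\<close>
    have "2 * (int a * int a) - int (card (?Q \<inter> A)) \<le> barrier a"
      using e(2) sum rows box by (simp add: half_energy_def algebra_simps)
    moreover have "int (card ?Q) = int a * int a - int a + 1"
      unfolding cQ using a by (simp add: of_nat_diff algebra_simps)
    ultimately have "card ?Q \<le> card (?Q \<inter> A)" by (simp add: barrier_def)
    then have "?Q \<inter> A = ?Q" using fin by (intro card_seteq) auto
    then show ?thesis by blast
  qed
  have perimQ: "card (exits (right N) ?Q) + card (exits (up N) ?Q) \<le> 2 * a"
    using perimeter_le_if_card_le[OF _ e(2) a0 cQ'(2)] fin by simp
  note nofull = no_full_lines[OF Q a0 a(2) cQ'(2) perimQ]
  have inj: "inj_on snd (exits (right N) ?Q)" "inj_on fst (exits (up N) ?Q)"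
    using inj_on_snd_exits[OF Q nofull(1)] inj_on_fst_exits[OF Q nofull(2)] sum by auto
  obtain X Y x y w h where XY: "P = X \<times> Y" "X \<noteq> {}" "Y \<noteq> {}"
    and X: "X = {z \<in> {1..int N}. (z - x) mod int N < int w}"
    and Y: "Y = {z \<in> {1..int N}. (z - y) mod int N < int h}"
    and card: "card X = w" "card Y = h" and wh: "w = a \<and> h = a - 1 \<or> w = a - 1 \<and> h = a"
    by (rule quasi_square_is_rectangle[OF P e(1) a c])
  have img: "fst ` ?Q = insert (fst v) X" "snd ` ?Q = insert (snd v) Y" using XY by auto
  have finXY: "finite X" "finite Y" using XY fin by (auto simp: finite_cartesian_product_iff)
  have v12: "fst v \<in> {1..int N}" "snd v \<in> {1..int N}" using v by (auto simp: V_def)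
  have rect: "P = rectangle N x y w h"
    using XY(1) rectangle_eq_product[OF X Y] by simp
  have "{v} \<in> bars N x y w h 1"
    using wh
  proof
    assume XYa: "w = a \<and> h = a - 1"
    \<comment> \<open>\<open>P\<close> already occupies all \<open>a\<close> columns of the box, so
      \<open>v\<close> opens a new row within an old column. The single exit of that column then
      ties \<open>v\<close> to an end of \<open>Y\<close>.\<close>
    then have vX: "fst v \<in> X" using box img(1) finXY card XYa by (metis card_insert_disjoint n_not_Suc_n)
    have vY: "snd v \<notin> Y" using vX XY(1) v(2) by (metis SigmaI prod.collapse)
    have mem: "(fst v, s) \<in> ?Q \<longleftrightarrow> s \<in> insert (snd v) Y" for s using vX XY(1) by (auto simp: prod_eq_iff)
    have "[snd v = y - 1] (mod int N) \<or> [snd v = y + int h] (mod int N)"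
    proof (rule adjacent_to_cyclic_interval[OF Y _ _ v12(2) vY])
      show "s = t" if "s \<in> insert (snd v) Y" "t \<in> insert (snd v) Y"
        "wrap N (s + 1) \<notin> insert (snd v) Y" "wrap N (t + 1) \<notin> insert (snd v) Y" for s t
        using col_unique_exit[OF inj(2), of "fst v" s t] that unfolding mem by blast
    qed (use XYa a in auto)
    moreover from vX have "(fst v - x) mod int N < int w" by (simp add: X)
    ultimately show ?thesis using XYa by (intro singleton_mem_bars[OF v(1)]) auto
  next
    assume XYa: "w = a - 1 \<and> h = a"
    then have vY: "snd v \<in> Y" using rows img(2) finXY card XYa by (metis card_insert_disjoint n_not_Suc_n)
    have vX: "fst v \<notin> X" using vY XY(1) v(2) by (metis SigmaI prod.collapse)
    have mem: "(s, snd v) \<in> ?Q \<longleftrightarrow> s \<in> insert (fst v) X" for s using vY XY(1) by (auto simp: prod_eq_iff)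
    have "[fst v = x - 1] (mod int N) \<or> [fst v = x + int w] (mod int N)"
    proof (rule adjacent_to_cyclic_interval[OF X _ _ v12(1) vX])
      show "s = t" if "s \<in> insert (fst v) X" "t \<in> insert (fst v) X"
        "wrap N (s + 1) \<notin> insert (fst v) X" "wrap N (t + 1) \<notin> insert (fst v) X" for s t
        using row_unique_exit[OF inj(1), of s "snd v" t] that unfolding mem by blast
    qed (use XYa a in auto)
    moreover from vY have "(snd v - y) mod int N < int h" by (simp add: Y)
    ultimately show ?thesis using XYa by (intro singleton_mem_bars[OF v(1)]) auto
  qed
  moreover have "?Q = rectangle N x y w h \<union> {v}" using rect by auto
  moreover have "(w, h) = (a, a - 1) \<or> (w, h) = (a - 1, a)" using wh by auto
  ultimately show ?thesis using QA unfolding rect_bar_def by blast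
qed

text \<open>With \<open>2 * a\<close> rows and columns in total, a flip cannot exchange a row for a column; hence a
  droplet of size between \<open>a * (a - 1) + 1\<close> and \<open>a * a - 1\<close> whose bounding box is not the square
  never becomes the square, the only droplet of size \<open>a * a\<close> below the barrier.\<close>

definition subcritical :: "nat \<Rightarrow> site set \<Rightarrow> bool" where
  "subcritical a P \<longleftrightarrow> card P \<le> a * (a - 1) \<or> card P < a * a \<and> card (fst ` P) \<noteq> a"

lemma subcritical_insert:
  assumes P: "P \<subseteq> V N" and v: "v \<in> V N" "v \<notin> P"
    and e: "half_energy N a A B P \<le> barrier a" "half_energy N a A B (insert v P) \<le> barrier a"
    and a: "2 \<le> a" "2 * a < N" and sub: "subcritical a P"
    and gate: "insert v P \<notin> rect_bar N A a (a - 1) 1"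
  shows "subcritical a (insert v P)"
proof (cases "card (insert v P) \<le> a * (a - 1)")
  case False
  have fin: "finite P" using P by (rule finite_subset_V)
  have a0: "0 < a" using a by simp
  have cQ: "card (insert v P) = Suc (card P)" using v fin by simp
  have aa: "a * (a - 1) + a = a * a" using a by (simp add: algebra_simps)
  show ?thesis
  proof (cases "card P \<le> a * (a - 1)")
    case True
    \<comment> \<open>Entering the critical range from the quasi-square: a square bounding box would
      put \<open>insert v P\<close> into the gate.\<close>
    then have "card P = a * (a - 1)" using False cQ by simp
    then show ?thesis
      using critical_droplet[OF P v e a] gate cQ aa a by (auto simp: subcritical_def)
  next
    case gt: False
    then have lt: "card P < a * a" and box: "card (fst ` P) \<noteq> a" using sub by (auto simp: subcritical_def)
    have Q: "insert v P \<subseteq> V N" using P v by simp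
    have cP': "a * (a - 1) < card P" "card P \<le> a * a" using gt lt by auto
    have cQ': "a * (a - 1) < card (insert v P)" "card (insert v P) \<le> a * a" using False lt cQ by auto
    \<comment> \<open>Neither side shrinks under insertion, and their sum is \<open>2 a\<close>
      before and after, so both are unchanged.\<close>
    have "card (fst ` P) \<le> card (fst ` insert v P)" "card (snd ` P) \<le> card (snd ` insert v P)"
      using fin by (auto intro!: card_mono)
    then have eq: "card (fst ` insert v P) = card (fst ` P)"
      using sides_sum(1)[OF P e(1) a0 a(2) cP'] sides_sum(1)[OF Q e(2) a0 a(2) cQ'] by linarith
    have "card (insert v P) \<noteq> a * a"
    proof
      assume "card (insert v P) = a * a"
      then have "card (fst ` insert v P) = a"
        using sides_sum(1)[OF Q e(2) a0 a(2) cQ'] card_le_cols_times_rows[of "insert v P"] fin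
        by (intro square_sides[of _ "card (snd ` insert v P)"]) auto
      then show False using eq box by simp
    qed
    then show ?thesis using cQ'(2) eq box by (simp add: subcritical_def)
  qed
qed (simp add: subcritical_def)

text \<open>A removal either lands at size at most \<open>a (a - 1)\<close>, which is subcritical
  outright, or stays in the range where the bounding box is rigid.\<close>

lemma subcritical_remove:
  assumes Q: "insert v P \<subseteq> V N" and v: "v \<notin> P"
    and e: "half_energy N a A B P \<le> barrier a" "half_energy N a A B (insert v P) \<le> barrier a"
    and a: "2 \<le> a" "2 * a < N" and sub: "subcritical a (insert v P)"
  shows "subcritical a P"
proof (cases "card P \<le> a * (a - 1)")
  case False
  have P: "P \<subseteq> V N" using Q by simp
  have fin: "finite P" using P by (rule finite_subset_V)
  have a0: "0 < a" using a by simp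
  have cQ: "card (insert v P) = Suc (card P)" using v fin by simp
  have box: "card (insert v P) < a * a" "card (fst ` insert v P) \<noteq> a"
    using sub False cQ by (auto simp: subcritical_def)
  have cP': "a * (a - 1) < card P" "card P \<le> a * a" using False box cQ by auto
  have cQ': "a * (a - 1) < card (insert v P)" "card (insert v P) \<le> a * a" using False box cQ by auto
  have "card (fst ` P) \<le> card (fst ` insert v P)" "card (snd ` P) \<le> card (snd ` insert v P)"
    using fin by (auto intro!: card_mono)
  then have "card (fst ` insert v P) = card (fst ` P)"
    using sides_sum(1)[OF P e(1) a0 a(2) cP'] sides_sum(1)[OF Q e(2) a0 a(2) cQ'] by linarith
  then show ?thesis using box cQ by (simp add: subcritical_def)
qed (simp add: subcritical_def)

section \<open>A reference path\<close>

text \<open>The reference path only ever adds sites, so it is described as a chain of droplets, each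
  new one within the barrier; \<open>path_if_grow\<close> turns such a chain into a path of
  configurations.\<close>

inductive grow :: "nat \<Rightarrow> site set \<Rightarrow> site set \<Rightarrow> site set \<Rightarrow> site set \<Rightarrow> bool" for a A B where
  "v \<in> V N \<Longrightarrow> v \<notin> P \<Longrightarrow> half_energy N a A B (insert v P) \<le> barrier a \<Longrightarrow> grow a A B P (insert v P)"

lemma half_energy_insert_le:
  assumes "finite P" and v: "v \<in> A" "v \<notin> B" "v \<notin> P"
    and x: "card (exits (right N) (insert v P)) \<le> card (exits (right N) P) + i"
    and y: "card (exits (up N) (insert v P)) \<le> card (exits (up N) P) + j"
  shows "half_energy N a A B (insert v P) \<le> half_energy N a A B P + int a * int (i + j) - 1"
proof -
  have "card (insert v P \<inter> A) = Suc (card (P \<inter> A))" using assms(1) v by simp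
  moreover have "insert v P \<inter> B = P \<inter> B" using v by auto
  moreover have "int a * int (card (exits (right N) (insert v P)) + card (exits (up N) (insert v P)))
      \<le> int a * int (card (exits (right N) P) + card (exits (up N) P) + (i + j))"
    using x y by (intro mult_left_mono) auto
  ultimately show ?thesis by (simp add: half_energy_def algebra_simps)
qed

text \<open>The first site of a bar has one occupied predecessor and costs at most
  \<open>a - 1\<close>, which an energy of at most \<open>a^2\<close> just permits. Every later site
  has predecessors in both directions and lowers the energy.\<close>

lemma grow_bar:
  fixes v :: "nat \<Rightarrow> site"
  assumes fin: "finite P" and P: "half_energy N a A B P \<le> int a * int a" and l: "1 \<le> l"
    and v: "\<And>q. q < l \<Longrightarrow> v q \<in> V N \<inter> A - B" "\<And>q. q < l \<Longrightarrow> v q \<notin> P \<union> v ` {..<q}"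
    and first: "v 0 \<in> right N ` P \<or> v 0 \<in> up N ` P"
    and rest: "\<And>q. 0 < q \<Longrightarrow> q < l \<Longrightarrow>
      v q \<in> right N ` (P \<union> v ` {..<q}) \<and> v q \<in> up N ` (P \<union> v ` {..<q})"
  shows "(grow a A B)\<^sup>*\<^sup>* P (P \<union> v ` {..<l}) \<and>
    half_energy N a A B (P \<union> v ` {..<l}) \<le> half_energy N a A B P + int a - int l"
proof -
  let ?P = "\<lambda>q. P \<union> v ` {..<q}" and ?e = "half_energy N a A B"
  have Suc: "?P (Suc q) = insert (v q) (?P q)" for q by (auto simp: lessThan_Suc)
  have finP: "finite (?P q)" for q using fin by simp
  have step: "grow a A B (?P q) (?P (Suc q))"
    if "q < l" "?e (insert (v q) (?P q)) \<le> ?e P + int a - 1" for q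
    unfolding Suc using that v P by (intro grow.intros) (auto simp: barrier_def)
  have "(grow a A B)\<^sup>*\<^sup>* P (?P q) \<and> ?e (?P q) \<le> ?e P + int a - int q" if "1 \<le> q" "q \<le> l" for q
    using that
  proof (induction q rule: nat_induct_at_least)
    case base
    have v0: "v 0 \<in> A" "v 0 \<notin> B" "v 0 \<notin> P" using v[of 0] l by auto
    have "?e (insert (v 0) P) \<le> ?e P + int a * int 1 - 1"
      using first
    proof
      assume "v 0 \<in> right N ` P"
      then have "card (exits (right N) (insert (v 0) P)) \<le> card (exits (right N) P)"
        by (rule card_exits_insert_pred_le[OF fin v0(3)])
      then show ?thesis
        using half_energy_insert_le[OF fin v0, of 0 1] card_exits_insert_le[OF fin] by simp
    next
      assume "v 0 \<in> up N ` P"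
      then have "card (exits (up N) (insert (v 0) P)) \<le> card (exits (up N) P)"
        by (rule card_exits_insert_pred_le[OF fin v0(3)])
      then show ?thesis
        using half_energy_insert_le[OF fin v0, of 1 0] card_exits_insert_le[OF fin] by simp
    qed
    then show ?case using step[of 0] l Suc[of 0] by auto
  next
    case (Suc q)
    have vq: "v q \<in> A" "v q \<notin> B" "v q \<notin> ?P q" using v[of q] Suc by auto
    have "v q \<in> right N ` ?P q" "v q \<in> up N ` ?P q" using rest[of q] Suc by auto
    then have "card (exits (right N) (insert (v q) (?P q))) \<le> card (exits (right N) (?P q)) + 0"
      "card (exits (up N) (insert (v q) (?P q))) \<le> card (exits (up N) (?P q)) + 0"
      using card_exits_insert_pred_le[OF finP vq(3)] by simp_all
    then have "?e (insert (v q) (?P q)) \<le> ?e (?P q) - 1"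
      using half_energy_insert_le[OF finP vq, of 0 0] by simp
    moreover have "grow a A B (?P q) (?P (Suc q))" using step[of q] Suc calculation by auto
    ultimately show ?case using Suc \<open>?P (Suc q) = insert (v q) (?P q)\<close> by (auto intro: rtranclp.rtrancl_into_rtrancl)
  qed
  then show ?thesis using l by blast
qed

text \<open>Offset coordinates: \<open>j\<close> counts columns from \<open>s\<close>, and
  \<open>i\<close> counts rows from row \<open>N\<close>, the representative of 0. Blocks may thus
  cross the seam of the torus.\<close>

definition pt :: "int \<Rightarrow> nat \<Rightarrow> nat \<Rightarrow> site" where
  "pt s j i = (wrap N (s + int j), wrap N (int i))"

definition block :: "int \<Rightarrow> nat \<Rightarrow> nat \<Rightarrow> site set" where
  "block s w h = {pt s j i | j i. j < w \<and> i < h}"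

lemma block_eq_image: "block s w h = (\<lambda>(j, i). pt s j i) ` ({..<w} \<times> {..<h})"
  by (auto simp: block_def)

lemma pt_in_block: "j < w \<Longrightarrow> i < h \<Longrightarrow> pt s j i \<in> block s w h"
  by (auto simp: block_def)

lemma right_pt: "right N (pt s j i) = pt s (Suc j) i"
  by (simp add: right_def pt_def ac_simps)

lemma up_pt: "up N (pt s j i) = pt s j (Suc i)"
  by (simp add: up_def pt_def ac_simps)

lemma pt_V: "pt s j i \<in> V N"
  by (simp add: pt_def V_def)

lemma pt_eq_iff:
  assumes "j < N" "i < N" "j' < N" "i' < N"
  shows "pt s j i = pt s j' i' \<longleftrightarrow> j = j' \<and> i = i'"
proof -
  have "[int x = int y] (mod int N) \<longleftrightarrow> x = y" if "x < N" "y < N" for x y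
    using that by (simp add: cong_def)
  then show ?thesis using assms by (auto simp: pt_def wrap_eq_iff cong_add_lcancel)
qed

lemma finite_block [simp]: "finite (block s w h)"
  by (simp add: block_eq_image)

lemma block_add_col: "block s (Suc w) h = block s w h \<union> (\<lambda>q. pt s w q) ` {..<h}"
  unfolding block_def less_Suc_eq by blast

lemma block_add_row: "block s w (Suc h) = block s w h \<union> (\<lambda>q. pt s q h) ` {..<w}"
  unfolding block_def less_Suc_eq by blast

lemma pt_in_block_iff:
  assumes "w \<le> N" "h \<le> N" "j < N" "i < N"
  shows "pt s j i \<in> block s w h \<longleftrightarrow> j < w \<and> i < h"
  using assms pt_eq_iff by (fastforce simp: block_def)

lemma strip_eq_block:
  assumes "w \<le> N"
  shows "strip N s w = block s w N"
proof (intro equalityI subsetI)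
  fix u assume u: "u \<in> strip N s w"
  define j i where "j = nat ((fst u - s) mod int N)" and "i = nat (snd u mod int N)"
  have "j < w" "i < N" using u N_ge_3 by (auto simp: strip_def j_def i_def nat_less_iff)
  moreover have "u = pt s j i"
  proof -
    have "[s + (fst u - s) mod int N = fst u] (mod int N)" "[snd u mod int N = snd u] (mod int N)"
      by (simp_all add: cong_add_mod_diff)
    then have "[fst u = s + int j] (mod int N)" "[snd u = int i] (mod int N)"
      using N_ge_3 by (auto simp: j_def i_def cong_sym_eq)
    then have "fst u = wrap N (s + int j)" "snd u = wrap N (int i)"
      using u eq_wrap_iff by (auto simp: strip_def V_def)
    then show ?thesis by (simp add: pt_def prod_eq_iff)
  qed
  ultimately show "u \<in> block s w N" using pt_in_block by simp
next
  fix u assume "u \<in> block s w N"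
  then obtain j i where u: "u = pt s j i" "j < w" by (auto simp: block_def)
  have "(wrap N (s + int j) - s) mod int N = int j" using u(2) assms by (simp add: wrap_mod)
  then show "u \<in> strip N s w" using u pt_V by (simp add: strip_def pt_def)
qed

lemma card_strip:
  assumes "w \<le> N"
  shows "card (strip N s w) = w * N"
proof -
  have "inj_on (\<lambda>(j, i). pt s j i) ({..<w} \<times> {..<N})"
    using assms by (auto simp: inj_on_def pt_eq_iff)
  then show ?thesis using assms by (simp add: strip_eq_block block_eq_image card_image card_cartesian_product)
qed

text \<open>The droplet first grows with height \<open>a\<close>, column by column, and then row by row. A new bar
  costs at most \<open>a - 1\<close> and a column of length \<open>a\<close> or a row of length at least \<open>a\<close> pays it back.\<close>

lemma grow_to_strip:
  assumes a: "1 \<le> a" "a \<le> w" and w: "w \<le> N" and A: "A = strip N s w" and AB: "A \<inter> B = {}"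
  shows "(grow a A B)\<^sup>*\<^sup>* {} A"
proof -
  let ?e = "half_energy N a A B"
  have A': "A = block s w N" using A strip_eq_block[OF w] by simp
  have mem: "pt s j i \<in> V N \<inter> A - B" if "j < w" "i < N" for j i
  proof -
    have "pt s j i \<in> A" using A' that pt_in_block by simp
    then show ?thesis using AB pt_V by blast
  qed
  \<comment> \<open>The bound is the energy of a \<open>1 x q\<close> bar in \<open>A\<close>,
    namely \<open>a (q + 1) - q\<close>.\<close>
  have first: "(grow a A B)\<^sup>*\<^sup>* {} (block s 1 q) \<and> ?e (block s 1 q) \<le> int a + int q * (int a - 1)"
    if "1 \<le> q" "q \<le> a" for q
    using that
  proof (induction q rule: nat_induct_at_least)
    case base
    have b: "block s 1 1 = {pt s 0 0}" by (auto simp: block_def)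
    have v: "pt s 0 0 \<in> V N \<inter> A - B" using mem[of 0 0] a w by simp
    have "?e (insert (pt s 0 0) {}) \<le> ?e {} + int a * int (1 + 1) - 1"
      using v card_exits_insert_le[of "{}" _ "pt s 0 0"] by (intro half_energy_insert_le) auto
    also have "\<dots> = 2 * int a - 1" by (simp add: half_energy_def)
    finally have e: "?e {pt s 0 0} \<le> 2 * int a - 1" .
    also have "\<dots> \<le> barrier a"
    proof -
      have "int a * 1 \<le> int a * int a" using a by (intro mult_left_mono) auto
      then show ?thesis by (simp add: barrier_def)
    qed
    finally have "grow a A B {} (insert (pt s 0 0) {})" using v by (intro grow.intros) auto
    then show ?case using e b by auto
  next
    case (Suc q)
    let ?v = "pt s 0 q" and ?P = "block s 1 q"
    have b: "block s 1 (Suc q) = insert ?v ?P" by (auto simp: block_add_row)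
    have q: "q < N" using Suc a w by simp
    have v: "?v \<in> V N \<inter> A - B" using mem[of 0 q] a q by simp
    have vP: "?v \<notin> ?P" using q by (subst pt_in_block_iff) auto
    have "?v = up N (pt s 0 (q - 1))" using up_pt[of s 0 "q - 1"] Suc by simp
    moreover have "pt s 0 (q - 1) \<in> ?P" using Suc by (intro pt_in_block) auto
    ultimately have "?v \<in> up N ` ?P" by (rule image_eqI)
    then have "card (exits (up N) (insert ?v ?P)) \<le> card (exits (up N) ?P)"
      using vP by (intro card_exits_insert_pred_le) auto
    then have "?e (insert ?v ?P) \<le> ?e ?P + int a * int (1 + 0) - 1"
      using v vP by (intro half_energy_insert_le card_exits_insert_le) auto
    also have "\<dots> \<le> int a + int (Suc q) * (int a - 1)" using Suc by (simp add: algebra_simps)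
    finally have e: "?e (insert ?v ?P) \<le> int a + int (Suc q) * (int a - 1)" .
    also have "\<dots> \<le> int a + int a * (int a - 1)"
      using Suc a by (intro add_left_mono mult_right_mono) auto
    also have "\<dots> \<le> barrier a" using a by (simp add: barrier_def algebra_simps)
    finally have "grow a A B ?P (insert ?v ?P)" using v vP by (intro grow.intros) auto
    then show ?case using Suc e b by (auto intro: rtranclp.rtrancl_into_rtrancl)
  qed
  \<comment> \<open>The first column ends at \<open>a + a (a - 1) = a^2\<close>; each further one
    costs at most \<open>a - a = 0\<close>.\<close>
  have cols: "(grow a A B)\<^sup>*\<^sup>* {} (block s j a) \<and> ?e (block s j a) \<le> int a * int a"
    if "1 \<le> j" "j \<le> w" for j
    using that
  proof (induction j rule: nat_induct_at_least)
    case base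
    show ?case using first[of a] a by (auto simp: algebra_simps)
  next
    case (Suc j)
    have "(grow a A B)\<^sup>*\<^sup>* (block s j a) (block s j a \<union> (\<lambda>q. pt s j q) ` {..<a}) \<and>
      ?e (block s j a \<union> (\<lambda>q. pt s j q) ` {..<a}) \<le> ?e (block s j a) + int a - int a"
    proof (rule grow_bar)
      show "?e (block s j a) \<le> int a * int a" using Suc by simp
      have left: "pt s j q \<in> right N ` block s j a" if "q < a" for q
        using right_pt[of s "j - 1" q] Suc that pt_in_block[of "j - 1" j q a s] by (intro image_eqI) auto
      show "pt s j 0 \<in> right N ` block s j a \<or> pt s j 0 \<in> up N ` block s j a" using left a by simp
      fix q assume q: "q < a"
      then show "pt s j q \<in> V N \<inter> A - B" using mem[of j q] Suc a w by simp
      show "pt s j q \<notin> block s j a \<union> pt s j ` {..<q}"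
        using q Suc a w by (auto simp: pt_in_block_iff pt_eq_iff)
      assume "0 < q"
      then have "pt s j q \<in> up N ` pt s j ` {..<q}"
        using up_pt[of s j "q - 1"] by (intro image_eqI[of _ _ "pt s j (q - 1)"]) auto
      then show "pt s j q \<in> right N ` (block s j a \<union> pt s j ` {..<q}) \<and>
          pt s j q \<in> up N ` (block s j a \<union> pt s j ` {..<q})"
        using left[OF q] by blast
    qed (use a in auto)
    then show ?case using Suc block_add_col by (auto intro: rtranclp_trans)
  qed
  \<comment> \<open>Exits are only bounded from above, so the row that closes the strip around the
    torus is treated like the others.\<close>
  have rows: "(grow a A B)\<^sup>*\<^sup>* {} (block s w h) \<and> ?e (block s w h) \<le> int a * int a"
    if "a \<le> h" "h \<le> N" for h
    using that
  proof (induction h rule: nat_induct_at_least)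
    case base
    show ?case using cols a by simp
  next
    case (Suc h)
    have h: "1 \<le> h" "h < N" using Suc a by auto
    have "(grow a A B)\<^sup>*\<^sup>* (block s w h) (block s w h \<union> (\<lambda>q. pt s q h) ` {..<w}) \<and>
      ?e (block s w h \<union> (\<lambda>q. pt s q h) ` {..<w}) \<le> ?e (block s w h) + int a - int w"
    proof (rule grow_bar)
      show "?e (block s w h) \<le> int a * int a" using Suc by simp
      have below: "pt s q h \<in> up N ` block s w h" if "q < w" for q
        using up_pt[of s q "h - 1"] h that pt_in_block[of q w "h - 1" h s] by (intro image_eqI) auto
      show "pt s 0 h \<in> right N ` block s w h \<or> pt s 0 h \<in> up N ` block s w h" using below a by simp
      fix q assume q: "q < w"
      then show "pt s q h \<in> V N \<inter> A - B" using mem[of q h] h by simp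
      show "pt s q h \<notin> block s w h \<union> (\<lambda>q. pt s q h) ` {..<q}"
        using q h w by (auto simp: pt_in_block_iff pt_eq_iff)
      assume "0 < q"
      then have "pt s q h \<in> right N ` (\<lambda>q. pt s q h) ` {..<q}"
        using right_pt[of s "q - 1" h] by (intro image_eqI[of _ _ "pt s (q - 1) h"]) auto
      then show "pt s q h \<in> right N ` (block s w h \<union> (\<lambda>q. pt s q h) ` {..<q}) \<and>
          pt s q h \<in> up N ` (block s w h \<union> (\<lambda>q. pt s q h) ` {..<q})"
        using below[OF q] by blast
    qed (use a in auto)
    then show ?case using Suc block_add_row a by (auto intro: rtranclp_trans)
  qed
  show ?thesis using rows[of N] A' a w by simp
qed

section \<open>Paths of configurations\<close>

text \<open>The sign \<open>s\<close> of the droplet is a parameter, so that one argument serves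
  droplets of +1 in -1 and droplets of -1 in +1.\<close>

definition config_of :: "int \<Rightarrow> site set \<Rightarrow> config" where
  "config_of s P = (\<lambda>v\<in>V N. if v \<in> P then s else - s)"

definition level :: "int \<Rightarrow> config \<Rightarrow> site set" where
  "level s \<sigma> = {v \<in> V N. \<sigma> v = s}"

lemma level_subset: "level s \<sigma> \<subseteq> V N"
  by (auto simp: level_def)

lemma level_config_of: "s \<in> {1, -1} \<Longrightarrow> P \<subseteq> V N \<Longrightarrow> level s (config_of s P) = P"
  by (auto simp: level_def config_of_def)

lemma config_of_level: "s \<in> {1, -1} \<Longrightarrow> \<sigma> \<in> configs N \<Longrightarrow> config_of s (level s \<sigma>) = \<sigma>"
  by (rule ext) (auto simp: config_of_def level_def configs_def PiE_iff extensional_def)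

lemma config_of_in_configs: "s \<in> {1, -1} \<Longrightarrow> config_of s P \<in> configs N"
  by (auto simp: config_of_def configs_def split: if_split_asm)

lemma finite_configs: "finite (configs N)"
  by (auto simp: configs_def intro: finite_PiE)

lemma card_flip_insert:
  assumes "s \<in> {1, -1}" "v \<in> V N" "v \<notin> P"
  shows "card {u \<in> V N. config_of s P u \<noteq> config_of s (insert v P) u} = 1"
proof -
  have "{u \<in> V N. config_of s P u \<noteq> config_of s (insert v P) u} = {v}"
    using assms by (auto simp: config_of_def)
  then show ?thesis by simp
qed

lemma flip_cases:
  assumes s: "s \<in> {1, -1}" and \<sigma>: "\<sigma> \<in> configs N" and \<tau>: "\<tau> \<in> configs N"
    and flip: "card {v \<in> V N. \<sigma> v \<noteq> \<tau> v} = 1"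
  obtains v where "v \<in> V N" "v \<notin> level s \<sigma>" "level s \<tau> = insert v (level s \<sigma>)"
    | v where "v \<in> V N" "v \<notin> level s \<tau>" "level s \<sigma> = insert v (level s \<tau>)"
proof -
  obtain v where v: "{v \<in> V N. \<sigma> v \<noteq> \<tau> v} = {v}" using flip card_1_singletonE by blast
  then have vV: "v \<in> V N" "\<sigma> v \<noteq> \<tau> v" by auto
  have other: "\<sigma> u = \<tau> u" if "u \<in> V N" "u \<noteq> v" for u using v that by blast
  have vals: "\<sigma> v \<in> {1, -1}" "\<tau> v \<in> {1, -1}" using \<sigma> \<tau> vV by (auto simp: configs_def)
  then consider "\<sigma> v \<noteq> s" "\<tau> v = s" | "\<sigma> v = s" "\<tau> v \<noteq> s" using vV s by auto
  then show ?thesis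
  proof cases
    case 1
    then have "level s \<tau> = insert v (level s \<sigma>)" using other vV by (fastforce simp: level_def)
    moreover have "v \<notin> level s \<sigma>" using 1 by (simp add: level_def)
    ultimately show ?thesis using that(1) vV by blast
  next
    case 2
    then have "level s \<sigma> = insert v (level s \<tau>)" using other vV by (fastforce simp: level_def)
    moreover have "v \<notin> level s \<tau>" using 2 by (simp add: level_def)
    ultimately show ?thesis using that(2) vV by blast
  qed
qed

lemma path_if_grow:
  assumes s: "s \<in> {1, -1}" and "(grow a A B)\<^sup>*\<^sup>* P Q"
    and "half_energy N a A B P \<le> barrier a" "P \<subseteq> V N"
  shows "Q \<subseteq> V N \<and> (\<exists>\<omega>. is_path N \<omega> \<and> hd \<omega> = config_of s P \<and> last \<omega> = config_of s Q \<and>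
    (\<forall>\<sigma>\<in>set \<omega>. \<exists>R\<subseteq>V N. \<sigma> = config_of s R \<and> half_energy N a A B R \<le> barrier a))"
  using assms(2)
proof (induction rule: rtranclp_induct)
  case base
  have "is_path N [config_of s P]" using s by (simp add: is_path_def config_of_in_configs)
  then show ?case using assms(3,4) by (intro conjI exI[of _ "[config_of s P]"]) auto
next
  case (step Q R)
  then obtain \<omega> where \<omega>: "is_path N \<omega>" "hd \<omega> = config_of s P" "last \<omega> = config_of s Q"
    "\<forall>\<sigma>\<in>set \<omega>. \<exists>R\<subseteq>V N. \<sigma> = config_of s R \<and> half_energy N a A B R \<le> barrier a" by blast
  obtain v where v: "v \<in> V N" "v \<notin> Q" "R = insert v Q" "half_energy N a A B R \<le> barrier a"
    using step(2) by (auto elim: grow.cases)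
  have R: "R \<subseteq> V N" using step v by simp
  have ne: "\<omega> \<noteq> []" using \<omega>(1) by (simp add: is_path_def)
  have "is_path N (\<omega> @ [config_of s R])"
    using \<omega>(1,3) ne card_flip_insert[OF s v(1,2)] config_of_in_configs[OF s]
    by (auto simp: is_path_def successively_append_iff v(3))
  moreover have "hd (\<omega> @ [config_of s R]) = config_of s P" using \<omega>(2) ne by simp
  ultimately show ?case
    using R v(4) \<omega>(4) by (intro conjI exI[of _ "\<omega> @ [config_of s R]"]) auto
qed

lemma sum_config_of:
  assumes s: "s \<in> {1, -1}" and "S \<subseteq> V N" "P \<subseteq> V N"
  shows "(\<Sum>v\<in>S. real_of_int (config_of s P v)) =
    real_of_int s * (2 * real (card (P \<inter> S)) - real (card S))"
proof -
  have fin: "finite S" using assms(2) by (rule finite_subset_V)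
  have "(\<Sum>v\<in>S. real_of_int (config_of s P v)) = (\<Sum>v\<in>S. real_of_int s * (2 * of_bool (v \<in> P) - 1))"
    using assms by (intro sum.cong) (auto simp: config_of_def)
  also have "\<dots> = real_of_int s * (2 * (\<Sum>v\<in>S. of_bool (v \<in> P)) - real (card S))"
    by (simp add: sum_distrib_left[symmetric] sum_subtractf)
  also have "(\<Sum>v\<in>S. of_bool (v \<in> P)) = real (card (P \<inter> S))"
    using fin by (simp add: Int_commute)
  finally show ?thesis .
qed

text \<open>An edge contributes -1 if it is a boundary edge and 1 otherwise, and the boundary edges
  number twice the exits.\<close>

lemma sum_edges_config_of:
  assumes s: "s \<in> {1, -1}" and P: "P \<subseteq> V N"
  shows "(\<Sum>e\<in>E N. \<Prod>v\<in>e. real_of_int (config_of s P v)) =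
    real (card (E N)) - 4 * real (card (exits (right N) P) + card (exits (up N) P))"
proof -
  let ?D = "\<lambda>e. e \<inter> P \<noteq> {} \<and> \<not> e \<subseteq> P"
  have "(\<Prod>v\<in>e. real_of_int (config_of s P v)) = 1 - 2 * of_bool (?D e)" if e: "e \<in> E N" for e
  proof -
    obtain u v where uv: "e = {u, v}" "u \<in> V N" "v \<in> V N" "u \<noteq> v"
      using e right_neq(1) up_neq(1) right_V up_V unfolding E_eq by (metis (no_types, lifting) UnE imageE)
    then have "(\<Prod>v\<in>e. real_of_int (config_of s P v)) =
        real_of_int (config_of s P u) * real_of_int (config_of s P v)" by simp
    then show ?thesis using uv s by (auto simp: config_of_def)
  qed
  then have "(\<Sum>e\<in>E N. \<Prod>v\<in>e. real_of_int (config_of s P v)) = (\<Sum>e\<in>E N. 1 - 2 * of_bool (?D e))"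
    by (intro sum.cong) auto
  also have "\<dots> = real (card (E N)) - 2 * (\<Sum>e\<in>E N. of_bool (?D e))"
    by (simp add: sum_subtractf sum_distrib_left)
  also have "(\<Sum>e\<in>E N. of_bool (?D e)) = real (card {e \<in> E N. ?D e})"
    by (simp add: Collect_conj_eq)
  finally show ?thesis using card_edge_boundary[OF P] by simp
qed

text \<open>\<open>K\<close> is the energy of the constant configuration \<open>-s\<close>. For
  \<open>s = -1\<close> the external field favours the droplet in \<open>B\<close>, whence the
  exchange of the strips.\<close>

lemma hamiltonian_config_of:
  assumes s: "s \<in> {1, -1}"
  obtains K where "\<And>P. P \<subseteq> V N \<Longrightarrow> hamiltonian N c n m k (real a) (config_of s P) =
    K + 2 * real_of_int (half_energy N a (if s = 1 then strip_A N c n else strip_B N c n m k)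
      (if s = 1 then strip_B N c n m k else strip_A N c n) P)"
proof (rule that)
  fix P assume P: "P \<subseteq> V N"
  have AB: "strip_A N c n \<subseteq> V N" "strip_B N c n m k \<subseteq> V N"
    by (auto simp: strip_A_def strip_B_def strip_def)
  show "hamiltonian N c n m k (real a) (config_of s P) =
    (real_of_int s * (real (card (strip_A N c n)) - real (card (strip_B N c n m k)))
      - real a / 2 * real (card (E N))) +
    2 * real_of_int (half_energy N a (if s = 1 then strip_A N c n else strip_B N c n m k)
      (if s = 1 then strip_B N c n m k else strip_A N c n) P)"
    using s unfolding hamiltonian_def sum_config_of[OF s AB(1) P] sum_config_of[OF s AB(2) P]
      sum_edges_config_of[OF s P] half_energy_def
    by (auto simp: algebra_simps)
qed

lemma height_in_image: "is_path N \<omega> \<Longrightarrow> height H \<omega> \<in> H ` configs N"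
proof -
  assume *: "is_path N \<omega>"
  then have "Max (H ` set \<omega>) \<in> H ` set \<omega>" by (intro Max_in) (auto simp: is_path_def)
  moreover have "H ` set \<omega> \<subseteq> H ` configs N" using * by (auto simp: is_path_def)
  ultimately show ?thesis unfolding height_def by blast
qed

lemma comm_height_le:
  assumes "\<omega> \<in> paths N \<eta> W"
  shows "comm_height N H \<eta> W \<le> height H \<omega>"
proof -
  have "finite (height H ` paths N \<eta> W)"
    using height_in_image by (intro finite_subset[OF _ finite_imageI[OF finite_configs]]) (auto simp: paths_def)
  then show ?thesis using assms by (auto simp: comm_height_def)
qed

end

text \<open>The step may use that both \<open>x\<close> and \<open>y\<close> lie on the list,
  because the energy bound is known only along the path.\<close>

lemma successively_invariant:
  assumes "successively R xs" "xs \<noteq> []" "I (hd xs)"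
    and "\<And>x y. x \<in> set xs \<Longrightarrow> y \<in> set xs \<Longrightarrow> R x y \<Longrightarrow> I x \<Longrightarrow> I y"
  shows "I (last xs)"
  using assms
proof (induction xs rule: induct_list012)
  case (3 x y zs)
  have "I y" using 3(3,5,6)[simplified] 3(6)[of x y] by simp
  moreover have "successively R (y # zs)" using 3(3) by simp
  ultimately have "I (last (y # zs))" using 3(6) by (intro 3(2)) auto
  then show ?case by simp
qed auto

section \<open>Optimal paths and the gate\<close>

context torus
begin

text \<open>An optimal path avoiding the gate would keep its droplet \<open>subcritical\<close> from
  the empty set up to its endpoint, but a target has at least \<open>a * a\<close> sites.\<close>

lemma opt_path_crosses_gate:
  assumes s: "s \<in> {1, -1}" and a: "2 \<le> a" "a < w" "2 * a < N" "w \<le> N"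
    and A: "A = strip N x w" and AB: "A \<inter> B = {}"
    and H: "\<And>P. P \<subseteq> V N \<Longrightarrow> H (config_of s P) = K + 2 * real_of_int (half_energy N a A B P)"
    and A_target: "config_of s A \<in> W"
    and target_size: "\<And>\<sigma>. \<sigma> \<in> W \<Longrightarrow> a * a \<le> card (level s \<sigma>)"
    and \<omega>: "\<omega> \<in> opt_paths N H (config_of s {}) W"
  shows "\<exists>R \<in> rect_bar N A a (a - 1) 1. config_of s R \<in> set \<omega>"
proof (rule ccontr)
  assume no_gate: "\<not> ?thesis"
  have path: "is_path N \<omega>" "hd \<omega> = config_of s {}" "last \<omega> \<in> W"
    using \<omega> by (auto simp: opt_paths_def paths_def)
  have "half_energy N a A B {} \<le> barrier a"
  proof -
    have "0 \<le> int a * int a" by simp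
    then have "0 \<le> barrier a" using a unfolding barrier_def by linarith
    then show ?thesis by (simp add: half_energy_def)
  qed
  then obtain \<rho> where \<rho>: "is_path N \<rho>" "hd \<rho> = config_of s {}" "last \<rho> = config_of s A"
    "\<forall>\<sigma>\<in>set \<rho>. \<exists>R\<subseteq>V N. \<sigma> = config_of s R \<and> half_energy N a A B R \<le> barrier a"
    using path_if_grow[OF s grow_to_strip[OF _ _ a(4) A AB, of a]] a by force
  \<comment> \<open>Optimality enters only here, through comparison with the growth path
    \<open>\<rho>\<close>.\<close>
  have "height H \<omega> \<le> height H \<rho>"
    using \<omega> comm_height_le[of \<rho>] \<rho>(1-3) A_target by (auto simp: opt_paths_def paths_def)
  also have "\<dots> \<le> K + 2 * real_of_int (barrier a)"
    unfolding height_def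
  proof (rule Max.boundedI)
    fix h assume "h \<in> H ` set \<rho>"
    then obtain \<sigma> where "\<sigma> \<in> set \<rho>" "h = H \<sigma>" by blast
    moreover from this obtain R where "R \<subseteq> V N" "\<sigma> = config_of s R" "half_energy N a A B R \<le> barrier a"
      using \<rho>(4) by metis
    ultimately show "h \<le> K + 2 * real_of_int (barrier a)" using H by simp
  qed (use \<rho>(1) in \<open>auto simp: is_path_def\<close>)
  finally have height: "height H \<omega> \<le> K + 2 * real_of_int (barrier a)" .
  have energy: "half_energy N a A B (level s \<sigma>) \<le> barrier a" if "\<sigma> \<in> set \<omega>" for \<sigma>
  proof -
    have "\<sigma> \<in> configs N" using that path(1) by (auto simp: is_path_def)
    then have "H \<sigma> = K + 2 * real_of_int (half_energy N a A B (level s \<sigma>))"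
      using H[OF level_subset, of s \<sigma>] config_of_level[OF s] by simp
    moreover have "H \<sigma> \<le> height H \<omega>" using that by (simp add: height_def)
    ultimately show ?thesis using height by simp
  qed
  have "subcritical a (level s (last \<omega>))"
  proof (rule successively_invariant[where I = "\<lambda>\<sigma>. subcritical a (level s \<sigma>)"])
    show "successively (\<lambda>\<sigma> \<tau>. card {v \<in> V N. \<sigma> v \<noteq> \<tau> v} = 1) \<omega>" "\<omega> \<noteq> []"
      using path(1) by (auto simp: is_path_def)
    show "subcritical a (level s (hd \<omega>))"
      using path(2) level_config_of[OF s, of "{}"] by (simp add: subcritical_def)
    fix \<sigma> \<tau> assume st: "\<sigma> \<in> set \<omega>" "\<tau> \<in> set \<omega>" "card {v \<in> V N. \<sigma> v \<noteq> \<tau> v} = 1"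
      and sub: "subcritical a (level s \<sigma>)"
    have conf: "\<sigma> \<in> configs N" "\<tau> \<in> configs N" using st path(1) by (auto simp: is_path_def)
    from flip_cases[OF s conf st(3)] show "subcritical a (level s \<tau>)"
    proof cases
      case (1 v)
      have "level s \<tau> \<notin> rect_bar N A a (a - 1) 1"
        using no_gate st(2) config_of_level[OF s conf(2)] by metis
      then show ?thesis
        using subcritical_insert[OF level_subset 1(1,2) energy[OF st(1)] _ a(1,3) sub]
          energy[OF st(2)] 1(3) by simp
    next
      case (2 v)
      then show ?thesis
        using subcritical_remove[of v "level s \<tau>" a A B] level_subset[of s \<sigma>] energy[OF st(1)]
          energy[OF st(2)] sub a by simp
    qed
  qed
  moreover have "a * (a - 1) < a * a" using a by simp
  ultimately show False using target_size[OF path(3)] unfolding subcritical_def by linarith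
qed

lemma set_config_eq: "set_config N P = config_of 1 P"
  by (simp add: set_config_def config_of_def)

lemma set_config_compl_eq: "set_config N (V N - P) = config_of (-1) P"
  by (rule ext) (simp add: set_config_def config_of_def)

lemma const_config_eq: "const_config N (- s) = config_of s {}"
  by (simp add: const_config_def config_of_def)

text \<open>The offset of a column from \<open>c\<close>, in \<open>{0..<N}\<close>, decides to which strips it belongs.\<close>

lemma mem_strip_iff:
  assumes "0 \<le> t" "t \<le> int N"
  shows "u \<in> strip N (c + t) w \<longleftrightarrow> u \<in> V N \<and>
    (let d = (fst u - c) mod int N in (if t \<le> d then d - t else d - t + int N) < int w)"
proof -
  define d where "d = (fst u - c) mod int N"
  have d: "0 \<le> d" "d < int N" using N_ge_3 by (auto simp: d_def)
  have "(fst u - (c + t)) mod int N = (d - t) mod int N"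
    by (simp add: d_def mod_diff_left_eq algebra_simps)
  also have "\<dots> = (if t \<le> d then d - t else d - t + int N)"
  proof (cases "t \<le> d")
    case False
    have "(d - t) mod int N = (d - t + int N) mod int N" by simp
    also have "\<dots> = d - t + int N" using False d assms by (intro mod_pos_pos_trivial) auto
    finally show ?thesis using False by simp
  qed (use d assms in simp)
  finally show ?thesis by (simp add: strip_def d_def Let_def)
qed

end

theorem lemma4p8:
  fixes N n m k \<alpha> :: nat and c :: int
  assumes "even N" and "N = n + m + 2 * k"
    and "3 \<le> n" and "n \<le> m"
    and "1 \<le> k" and "real k < real N / 2"
    and "2 \<le> \<alpha>" and "\<alpha> < n"
  shows "(\<forall>\<omega> \<in> opt_paths N (hamiltonian N c n m k (real \<alpha>)) (const_config N (-1)) (target N c n k).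
            \<exists>\<sigma>\<^sub>A \<in> gate_A N c n \<alpha>. \<sigma>\<^sub>A \<in> set \<omega>) \<and>
         (\<forall>\<omega> \<in> opt_paths N (hamiltonian N c n m k (real \<alpha>)) (const_config N 1) (target N c n k).
            \<exists>\<sigma>\<^sub>B \<in> gate_B N c n m k \<alpha>. \<sigma>\<^sub>B \<in> set \<omega>)"
proof -
  interpret torus N using assms by unfold_locales simp
  let ?A = "strip_A N c n" and ?B = "strip_B N c n m k" and ?ext = "strip_A_ext N c n"
  let ?H = "hamiltonian N c n m k (real \<alpha>)"
  \<comment> \<open>The first bound comes from \<open>\<alpha> < n\<close> and
    \<open>n \<le> m\<close>, as \<open>n + m\<close> is at most \<open>N\<close>.\<close>
  have \<alpha>N: "2 * \<alpha> < N" "n \<le> N" "m \<le> N" using assms by auto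
  have d_bounds: "0 \<le> (fst u - c) mod int N" "(fst u - c) mod int N < int N" for u :: site
    using N_ge_3 by auto
  have A_iff: "u \<in> ?A \<longleftrightarrow> u \<in> V N \<and> (fst u - c) mod int N < int n" for u
    by (simp add: strip_A_def strip_def)
  have B_iff: "u \<in> ?B \<longleftrightarrow> u \<in> V N \<and> int (n + k) \<le> (fst u - c) mod int N \<and>
      (fst u - c) mod int N < int (n + k + m)" for u
    using mem_strip_iff[of "int n + int k" u c m] d_bounds[of u] assms(2)
    by (auto simp: strip_B_def Let_def algebra_simps split: if_splits)
  have S2_iff: "u \<in> strip N (c - int p) p \<longleftrightarrow> u \<in> V N \<and> int N - int p \<le> (fst u - c) mod int N"
    if "p \<le> k" for p u
  proof -
    \<comment> \<open>Replaces the offset \<open>-p\<close> by \<open>N - p\<close>, since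
      \<open>mem_strip_iff\<close> asks for one between 0 and \<open>N\<close>.\<close>
    have "strip N (c - int p) p = strip N (c + (int N - int p)) p"
      by (simp add: strip_def algebra_simps) (metis (no_types, opaque_lifting) minus_mod_self2 add_diff_eq diff_diff_eq2 diff_add_eq)
    then show ?thesis
      using mem_strip_iff[of "int N - int p" u c p] d_bounds[of u] assms(2) that
      by (auto simp: Let_def split: if_splits)
  qed
  have S1_iff: "u \<in> strip N (c + int n) l \<longleftrightarrow> u \<in> V N \<and> int n \<le> (fst u - c) mod int N \<and>
      (fst u - c) mod int N < int (n + l)" if "l \<le> k" for l u
    using mem_strip_iff[of "int n" u c l] d_bounds[of u] assms(2) that
    by (auto simp: Let_def split: if_splits)
  have ext_iff: "u \<in> ?ext l p \<longleftrightarrow> u \<in> V N \<and>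
      ((fst u - c) mod int N < int (n + l) \<or> int N - int p \<le> (fst u - c) mod int N)"
    if "l \<le> k" "p \<le> k" for l p u
    unfolding strip_A_ext_def Un_iff A_iff S1_iff[OF that(1)] S2_iff[OF that(2)] by auto
  have target_iff: "\<sigma> \<in> target N c n k \<longleftrightarrow> (\<exists>l\<le>k. \<exists>p\<le>k. \<sigma> = set_config N (?ext l p))" for \<sigma>
    by (simp add: target_def Bex_def)
  have AB: "?A \<inter> ?B = {}" "?B \<inter> ?A = {}" using A_iff B_iff by auto
  have ext_V: "?ext l p \<subseteq> V N" for l p by (auto simp: strip_A_ext_def strip_A_def strip_def)
  have A_ext: "?A \<subseteq> ?ext l p" for l p by (auto simp: strip_A_ext_def)
  have "u \<in> ?ext 0 0 \<longleftrightarrow> u \<in> ?A" for u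
    using ext_iff[of 0 0 u] A_iff[of u] d_bounds[of u] by auto
  then have ext_0: "?ext 0 0 = ?A" by blast
  \<comment> \<open>Growing +1 over exactly \<open>A\<close> reaches the target with
    \<open>l = p = 0\<close>.\<close>
  have "set_config N (?ext 0 0) \<in> target N c n k" using target_iff by blast
  then have A_target: "config_of 1 ?A \<in> target N c n k" by (simp only: ext_0 set_config_eq)
  have B_ext: "?B \<subseteq> V N - ?ext l p" if "l \<le> k" "p \<le> k" for l p
  proof
    fix u assume "u \<in> ?B"
    then show "u \<in> V N - ?ext l p" using ext_iff[OF that, of u] B_iff[of u] assms(2) that by auto
  qed
  have "u \<in> V N - ?B \<longleftrightarrow> u \<in> ?ext k k" for u
    using ext_iff[of k k u] B_iff[of u] d_bounds[of u] assms(2) by auto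
  then have ext_k: "V N - ?B = ?ext k k" by blast
  \<comment> \<open>Growing -1 over exactly \<open>B\<close> reaches the target with
    \<open>l = p = k\<close>.\<close>
  have "set_config N (?ext k k) \<in> target N c n k" using target_iff by blast
  then have B_target: "config_of (-1) ?B \<in> target N c n k"
    by (simp only: ext_k[symmetric] set_config_compl_eq)
  have size: "\<alpha> * \<alpha> \<le> l * N" if "n \<le> l" for l
    using that assms by (intro mult_mono) auto
  have A_size: "\<alpha> * \<alpha> \<le> card (level 1 \<sigma>)" if in_target: "\<sigma> \<in> target N c n k" for \<sigma>
  proof -
    obtain l p where "\<sigma> = config_of 1 (?ext l p)"
      using iffD1[OF target_iff in_target] unfolding set_config_eq by blast
    then have "level 1 \<sigma> = ?ext l p" using level_config_of[of 1, OF _ ext_V] by simp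
    then have "card ?A \<le> card (level 1 \<sigma>)"
      using card_mono[OF finite_subset_V[OF ext_V] A_ext] by simp
    then show ?thesis using card_strip[OF \<alpha>N(2), of c] size[of n] by (simp add: strip_A_def)
  qed
  \<comment> \<open>For the sign -1 the droplet of a target is the complement of an extension of
    \<open>A\<close>, which contains all of \<open>B\<close>.\<close>
  have B_size: "\<alpha> * \<alpha> \<le> card (level (-1) \<sigma>)" if in_target: "\<sigma> \<in> target N c n k" for \<sigma>
  proof -
    obtain l p where lp: "\<sigma> = set_config N (?ext l p)" "l \<le> k" "p \<le> k" using iffD1[OF target_iff in_target] by blast
    then have "\<sigma> = config_of (-1) (V N - ?ext l p)"
      using set_config_compl_eq[of "V N - ?ext l p"] ext_V by (simp add: double_diff)
    then have "level (-1) \<sigma> = V N - ?ext l p" using level_config_of[of "-1"] by simp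
    then have "card ?B \<le> card (level (-1) \<sigma>)" using card_mono[OF _ B_ext[OF lp(2,3)]] by simp
    then show ?thesis using card_strip[OF \<alpha>N(3)] size[of m] assms(4) by (simp add: strip_B_def)
  qed
  show ?thesis
  proof (intro conjI ballI)
    fix \<omega> assume \<omega>: "\<omega> \<in> opt_paths N ?H (const_config N (-1)) (target N c n k)"
    obtain K where K: "\<And>P. P \<subseteq> V N \<Longrightarrow> ?H (config_of 1 P) = K + 2 * real_of_int (half_energy N \<alpha> ?A ?B P)"
      using hamiltonian_config_of[of 1 c n m k \<alpha>] by auto
    have "\<exists>R \<in> rect_bar N ?A \<alpha> (\<alpha> - 1) 1. config_of 1 R \<in> set \<omega>"
    proof (rule opt_path_crosses_gate[OF _ _ _ _ _ strip_A_def AB(1) K A_target A_size])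
      show "\<omega> \<in> opt_paths N ?H (config_of 1 {}) (target N c n k)" using \<omega> const_config_eq[of 1] by simp
    qed (use assms \<alpha>N in auto)
    then show "\<exists>\<sigma>\<^sub>A \<in> gate_A N c n \<alpha>. \<sigma>\<^sub>A \<in> set \<omega>" by (auto simp: gate_A_def set_config_eq)
  next
    fix \<omega> assume \<omega>: "\<omega> \<in> opt_paths N ?H (const_config N 1) (target N c n k)"
    obtain K where K: "\<And>P. P \<subseteq> V N \<Longrightarrow> ?H (config_of (-1) P) = K + 2 * real_of_int (half_energy N \<alpha> ?B ?A P)"
      using hamiltonian_config_of[of "-1" c n m k \<alpha>] by auto
    have "\<exists>R \<in> rect_bar N ?B \<alpha> (\<alpha> - 1) 1. config_of (-1) R \<in> set \<omega>"
    proof (rule opt_path_crosses_gate[OF _ _ _ _ _ strip_B_def AB(2) K B_target B_size])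
      show "\<omega> \<in> opt_paths N ?H (config_of (-1) {}) (target N c n k)" using \<omega> const_config_eq[of "-1"] by simp
    qed (use assms \<alpha>N in auto)
    then show "\<exists>\<sigma>\<^sub>B \<in> gate_B N c n m k \<alpha>. \<sigma>\<^sub>B \<in> set \<omega>" by (auto simp: gate_B_def set_config_compl_eq)
  qed
qed

end
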